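(* Let $n\ge 4$. Among all orientations of unicyclic graphs on $n$ vertices, $\overrightarrow{P_n^4}^{+}$ is the unique oriented graph, up to switching-equivalence (and isomorphism), with maximal skew energy.
   Context: Graphs are finite, simple and undirected; an orientation $\overrightarrow{G}$ of $G$ assigns a direction to each edge. The skew adjacency matrix $S(\overrightarrow{G})=(s_{i,j})$ has $s_{i,j}=1$, $s_{j,i}=-1$ if $i\to j$ is an arc, and $s_{i,j}=s_{j,i}=0$ if $i,j$ are non-adjacent. The skew energy is $\mathcal{E}_s(\overrightarrow{G})=\sum_{i=1}^n|\lambda_i|$, where $\lambda_1,\dots,\lambda_n$ are the eigenvalues of $S(\overrightarrow{G})$ with multiplicity. A unicyclic graph is a connected graph with equally many vertices and edges. $P_n^{\ell}$ is the $n$-vertex unicyclic graph obtained by joining, by an edge, a vertex of the cycle $C_\ell$ to a terminal vertex of the path $P_{n-\ell}$ (with $P_\ell^\ell=C_\ell$). For a unicyclic graph $G$, $\overrightarrow{G}^{+}$ denotes an orientation in which exactly one edge of the unique cycle has direction (around the cycle) opposite to all other cycle edges, the edges off the cycle being oriented arbitrarily. Two orientations of a graph $G$ are switching-equivalent if one is obtained from the other by a sequence of switchings, where switching with respect to $W\subseteq V(G)$ reverses all arcs between $W$ and $V(G)\setminus W$. *)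

theory Defs
  imports
    "Graph_Theory.Pair_Digraph"
    "Graph_Theory.Digraph_Component"
    "Graph_Theory.Digraph_Isomorphism"
    "Jordan_Normal_Form.Char_Poly"
    "HOL-Computational_Algebra.Computational_Algebra"
begin

text \<open>
  A finite simple undirected graph is a \<^locale>\<open>pair_graph\<close>, that is, a finite loop-free
  digraph containing both arcs \<open>(u, v)\<close> and \<open>(v, u)\<close> for each edge \<open>{u, v}\<close>.
  An oriented graph contains exactly one of these two arcs. Both have the record type
  \<open>'a pair_pre_digraph\<close>.
\<close>

definition edge_set :: "'a pair_pre_digraph \<Rightarrow> 'a set set" where
  "edge_set G = {{u, v} | u v. (u, v) \<in> parcs G}"

definition unicyclic :: "'a pair_pre_digraph \<Rightarrow> bool" where
  "unicyclic G \<longleftrightarrow>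
     pair_graph G \<and> Digraph_Component.connected (with_proj G) \<and>
     card (edge_set G) = card (pverts G)"

definition orientation_of :: "'a pair_pre_digraph \<Rightarrow> 'a pair_pre_digraph \<Rightarrow> bool" where
  "orientation_of G D \<longleftrightarrow> mk_symmetric (with_proj D) = G \<and> asym (parcs D)"

text \<open>
  Graphs on \<open>n\<close> vertices have the vertices \<open>0, \<dots>, n - 1\<close>, which are also the indices of
  the rows and columns of the skew adjacency matrix.
\<close>

definition oriented_unicyclic :: "nat \<Rightarrow> nat pair_pre_digraph set" where
  "oriented_unicyclic n = {D. \<exists>G. unicyclic G \<and> pverts G = {..<n} \<and> orientation_of G D}"

text \<open>Meaningful only if the vertex set of \<open>D\<close> is \<open>{..<n}\<close> for some \<open>n\<close>.\<close>

definition skew_adj_matrix :: "nat pair_pre_digraph \<Rightarrow> complex mat" where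
  "skew_adj_matrix D = mat (card (pverts D)) (card (pverts D))
     (\<lambda>(i, j). if (i, j) \<in> parcs D then 1 else if (j, i) \<in> parcs D then - 1 else 0)"

text \<open>\<^const>\<open>proots\<close> is the multiset of roots, so eigenvalues are counted with multiplicity.\<close>

definition skew_energy :: "nat pair_pre_digraph \<Rightarrow> real" where
  "skew_energy D = (\<Sum>\<mu>\<in>#proots (char_poly (skew_adj_matrix D)). cmod \<mu>)"

text \<open>
  The graph \<open>P\<^sub>n\<^sup>l\<close> (for \<open>3 \<le> l \<le> n\<close>): the cycle \<open>0, \<dots>, l - 1\<close>, the path
  \<open>l, \<dots>, n - 1\<close> and, unless \<open>l = n\<close>, the joining edge \<open>{0, l}\<close>.
\<close>

definition cycle_path_graph :: "nat \<Rightarrow> nat \<Rightarrow> nat pair_pre_digraph" where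
  "cycle_path_graph n l = mk_symmetric (with_proj
     \<lparr>pverts = {..<n},
      parcs = {(i, Suc i mod l) | i. i < l}
            \<union> {(i, Suc i) | i. l \<le> i \<and> Suc i < n}
            \<union> (if l < n then {(0, l)} else {})\<rparr>)"

text \<open>
  The library's \<^const>\<open>pre_digraph.cycle\<close> is a directed notion: in a symmetric digraph the closed
  walk \<open>u, v, u\<close> is one. Hence the following notion of a cycle of a simple graph.
\<close>

definition is_graph_cycle :: "'a pair_pre_digraph \<Rightarrow> 'a list \<Rightarrow> bool" where
  "is_graph_cycle G c \<longleftrightarrow>
     3 \<le> length c \<and> distinct c \<and>
     (\<forall>i<length c. (c ! i, c ! (Suc i mod length c)) \<in> parcs G)"

text \<open>
  The list \<open>c\<close> runs around the unique cycle of \<open>G\<close>; the existential quantifier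
  leaves open its starting point and sense. In that sense, all cycle arcs but one point forward.
\<close>

definition plus_orientation :: "'a pair_pre_digraph \<Rightarrow> 'a pair_pre_digraph \<Rightarrow> bool" where
  "plus_orientation G D \<longleftrightarrow>
     unicyclic G \<and> orientation_of G D \<and>
     (\<exists>c. is_graph_cycle G c \<and>
          card {i. i < length c \<and> (c ! (Suc i mod length c), c ! i) \<in> parcs D} = 1)"

definition switching :: "'a set \<Rightarrow> 'a pair_pre_digraph \<Rightarrow> 'a pair_pre_digraph" where
  "switching W D =
     \<lparr>pverts = pverts D,
      parcs = {(u, v). if u \<in> W \<longleftrightarrow> v \<in> W then (u, v) \<in> parcs D else (v, u) \<in> parcs D}\<rparr>"

definition switching_equivalent :: "'a pair_pre_digraph \<Rightarrow> 'a pair_pre_digraph \<Rightarrow> bool" where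
  "switching_equivalent = (\<lambda>D D'. \<exists>W \<subseteq> pverts D. D' = switching W D)\<^sup>*\<^sup>*"

end

theory Submission
  imports Defs "HOL-Real_Asymp.Real_Asymp"
begin

text \<open>
  The coefficients of the characteristic polynomial of a skew adjacency matrix \<open>S\<close> are the sums
  \<open>e\<^sub>j\<close> of its principal minors of order \<open>2 j\<close>, and all eigenvalues are imaginary. As in Coulson's
  integral formula, the energy is therefore strictly increasing in these coefficients, and it
  suffices to compare them one by one.

  If \<open>u\<close> is a leaf with neighbour \<open>v\<close>, then \<open>e\<^sub>j(G) = e\<^sub>j(G - u) + e\<^sub>j\<^sub>-\<^sub>1(G - u - v)\<close>. Graphs with at
  most one cycle, connected or not, are closed under deleting vertices, and for the leaf of
  \<open>P\<^sub>n\<^sup>4\<close>, where \<open>n \<ge> 6\<close>, the two smaller graphs are \<open>P\<^sub>n\<^sub>-\<^sub>1\<^sup>4\<close> and \<open>P\<^sub>n\<^sub>-\<^sub>2\<^sup>4\<close>. So \<open>\<bar>e\<^sub>j(G)\<bar> \<le> e\<^sub>j(P\<^sub>n\<^sup>4)\<close>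
  follows by induction once the cycles are treated. There \<open>(n - 2 j) e\<^sub>j(C\<^sub>n)\<close> is the sum of
  \<open>e\<^sub>j(C\<^sub>n - v)\<close> over all \<open>v\<close>, and \<open>\<bar>det S\<bar> \<le> 4\<close> as at most four permutations contribute.
  By the same induction, equality for \<open>j = 2\<close> alone forces \<open>G\<close> to be \<open>P\<^sub>n\<^sup>4\<close> with the orientation \<open>+\<close>.
\<close>

section \<open>Principal minors of skew matrices\<close>

text \<open>Two obstacles shape the induction. On four and five vertices the leaf recursion leaves
  the family, and there its two summands cannot be bounded independently: on five vertices this
  would give \<open>4 + 3\<close>, while the true maximum is \<open>6\<close>. Moreover a cycle has
  no leaf, and double counting is silent about the coefficient with \<open>2 * j = n\<close>, where
  the factor \<open>n - 2 * j\<close> is zero; this is the place of the determinant bound.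
  Coefficients are compared through absolute values. The triangle inequality for the characteristic
  polynomial thus replaces the fact that principal minors of a real skew matrix are squares of
  Pfaffians. In the extremal graph the orientation matters through one number, the product of the
  four signs around the 4-cycle. The value \<open>-1\<close> makes the two perfect matchings
  reinforce each other, so that the minor is \<open>4\<close> and not \<open>0\<close>. Switching
  preserves this product, and it is a complete invariant because only one edge lies off a spanning
  tree. The coefficient with \<open>j = 1\<close> is the number of edges, the same for all unicyclic
  graphs on \<open>n\<close> vertices, so \<open>j = 2\<close> is the first that can tell them
  apart.\<close>

locale skew_form =
  fixes s :: "'a \<Rightarrow> 'a \<Rightarrow> int"
  assumes skew: "s j i = - s i j"
    and abs_le_1: "\<bar>s i j\<bar> \<le> 1"
begin

lemma diag_zero [simp]: "s i i = 0"
  using skew[of i i] by simp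

lemma s_cases: "s i j = 0 \<or> s i j = 1 \<or> s i j = -1"
  using abs_le_1[of i j] by linarith

lemma s_sym_nz: "s i j \<noteq> 0 \<longleftrightarrow> s j i \<noteq> 0"
  using skew[of i j] by simp

lemma s_square: "s i j \<noteq> 0 \<Longrightarrow> s i j * s i j = 1"
  using s_cases[of i j] by auto

definition minor :: "'a set \<Rightarrow> int" where
  "minor Y = (\<Sum>\<pi> | \<pi> permutes Y. sign \<pi> * (\<Prod>i\<in>Y. s i (\<pi> i)))"

definition minor_sum :: "'a set \<Rightarrow> nat \<Rightarrow> int" where
  "minor_sum X j = (\<Sum>Y | Y \<subseteq> X \<and> card Y = 2 * j. minor Y)"

definition nbrs :: "'a set \<Rightarrow> 'a \<Rightarrow> 'a set" where
  "nbrs X v = {w \<in> X. s v w \<noteq> 0}"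

abbreviation deg :: "'a set \<Rightarrow> 'a \<Rightarrow> nat" where
  "deg X v \<equiv> card (nbrs X v)"

lemma minor_empty [simp]: "minor {} = 1"
  by (simp add: minor_def)

text \<open>Inverting the permutation transposes the matrix: each of the \<open>card Y\<close>
  factors changes sign, the sign of the permutation does not. So the sum equals its own
  negative.\<close>

lemma minor_odd:
  assumes "finite Y" "odd (card Y)"
  shows "minor Y = 0"
proof -
  have "minor Y = (\<Sum>\<pi> | \<pi> permutes Y. sign (inv_into UNIV \<pi>) * (\<Prod>i\<in>Y. s i (inv_into UNIV \<pi> i)))"
    unfolding minor_def by (rule sum.reindex_bij_witness[of _ "inv_into UNIV" "inv_into UNIV"])
      (auto simp: permutes_inv permutes_inv_inv)
  also have "\<dots> = (\<Sum>\<pi> | \<pi> permutes Y. - (sign \<pi> * (\<Prod>i\<in>Y. s i (\<pi> i))))"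
  proof (rule sum.cong)
    fix \<pi> assume "\<pi> \<in> {\<pi>. \<pi> permutes Y}"
    hence p: "\<pi> permutes Y" by simp
    have "(\<Prod>i\<in>Y. s i (inv_into UNIV \<pi> i)) = (\<Prod>i\<in>Y. s (\<pi> i) i)"
      by (rule sym, rule prod.reindex_bij_witness[of _ "inv_into UNIV \<pi>" \<pi>])
         (use p in \<open>auto simp: permutes_inverses permutes_in_image permutes_inv\<close>)
    also have "\<dots> = (\<Prod>i\<in>Y. - 1 * s i (\<pi> i))"
      by (rule prod.cong[OF refl]) (simp, rule skew)
    also have "\<dots> = (-1) ^ card Y * (\<Prod>i\<in>Y. s i (\<pi> i))"
      by (simp only: prod.distrib prod_constant)
    finally show "sign (inv_into UNIV \<pi>) * (\<Prod>i\<in>Y. s i (inv_into UNIV \<pi> i)) = - (sign \<pi> * (\<Prod>i\<in>Y. s i (\<pi> i)))"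
      using assms p by (simp add: sign_inverse permutes_imp_permutation)
  qed simp
  also have "\<dots> = - minor Y" by (simp add: minor_def sum_negf)
  finally show ?thesis by simp
qed

lemma minor_isolated:
  assumes "finite Y" "u \<in> Y" "nbrs Y u = {}"
  shows "minor Y = 0"
  unfolding minor_def
proof (rule sum.neutral, rule ballI)
  fix \<pi> assume "\<pi> \<in> {\<pi>. \<pi> permutes Y}"
  hence "\<pi> u \<in> Y" using assms by (simp add: permutes_in_image)
  hence "s u (\<pi> u) = 0" using assms by (auto simp: nbrs_def)
  hence "(\<Prod>i\<in>Y. s i (\<pi> i)) = 0" using assms by (meson prod_zero)
  thus "sign \<pi> * (\<Prod>i\<in>Y. s i (\<pi> i)) = 0" by simp
qed

text \<open>As \<open>q\<close> fixes \<open>a\<close>, the index \<open>b\<close> is the image of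
  \<open>a\<close>: this is the expansion along row \<open>a\<close>, with the signs still inside
  \<open>f\<close>.\<close>

lemma sum_permutes_insert:
  fixes f :: "('b \<Rightarrow> 'b) \<Rightarrow> int"
  assumes "finite S" "a \<notin> S"
  shows "(\<Sum>p | p permutes insert a S. f p) =
    (\<Sum>b\<in>insert a S. \<Sum>q | q permutes S. f (transpose a b \<circ> q))"
proof -
  have inj: "inj_on (\<lambda>(b, p). transpose a b \<circ> p) {(b, p). b \<in> insert a S \<and> p \<in> {p. p permutes S}}"
  proof (rule inj_onI, clarsimp)
    fix b p c q
    assume *: "p permutes S" "q permutes S" "transpose a b \<circ> p = transpose a c \<circ> q"
    have "p a = a" "q a = a" using * assms by (auto simp: permutes_not_in)
    hence bc: "b = c" using fun_cong[OF *(3), of a] by simp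
    have "p = q"
    proof
      fix x
      have "transpose a b (transpose a b (p x)) = transpose a b (transpose a b (q x))"
        using fun_cong[OF *(3), of x] bc by simp
      thus "p x = q x" by simp
    qed
    thus "b = c \<and> p = q" using bc by simp
  qed
  have "(\<Sum>p | p permutes insert a S. f p) =
     (\<Sum>(b, p)\<in>{(b, p). b \<in> insert a S \<and> p \<in> {p. p permutes S}}. f (transpose a b \<circ> p))"
    unfolding permutes_insert by (subst sum.reindex[OF inj]) (simp add: case_prod_unfold o_def)
  also have "{(b, p). b \<in> insert a S \<and> p \<in> {p. p permutes S}} = insert a S \<times> {p. p permutes S}"
    by auto
  finally show ?thesis by (simp only: sum.cartesian_product)
qed

text \<open>Only permutations that swap \<open>u\<close> and \<open>v\<close> contribute.\<close>

lemma minor_leaf: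
  assumes "finite Y" "u \<in> Y" "nbrs Y u = {v}"
  shows "minor Y = minor (Y - {u, v})"
proof -
  define S where "S = Y - {u}"
  have v: "v \<in> S" "s u v \<noteq> 0" "u \<noteq> v" using assms unfolding nbrs_def S_def by auto
  have Y: "Y = insert u S" "u \<notin> S" "finite S" using assms by (auto simp: S_def)
  have S': "S - {v} = Y - {u, v}" by (auto simp: S_def)
  define F where "F \<pi> = sign \<pi> * (\<Prod>i\<in>Y. s i (\<pi> i))" for \<pi>
  define T where "T = {q. q permutes S - {v}}"
  have only: "s u b = 0" if "b \<in> Y" "b \<noteq> v" for b
    using assms(3) that by (auto simp: nbrs_def)
  have F0: "F (transpose u b \<circ> q) = 0" if "b \<in> insert u S" "q permutes S" "b \<noteq> v" for b q
  proof -
    have "q u = u" using that(2) Y(2) by (simp add: permutes_not_in)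
    hence "s u ((transpose u b \<circ> q) u) = 0" using only[of b] that Y by auto
    hence "(\<Prod>i\<in>Y. s i ((transpose u b \<circ> q) i)) = 0" using assms by (meson prod_zero)
    thus ?thesis by (simp add: F_def)
  qed
  have "minor Y = (\<Sum>b\<in>insert u S. \<Sum>q | q permutes S. F (transpose u b \<circ> q))"
    unfolding minor_def F_def[symmetric]
    by (subst (1) Y(1), subst sum_permutes_insert[OF Y(3,2)]) simp
  also have "\<dots> = (\<Sum>b\<in>{v}. \<Sum>q | q permutes S. F (transpose u b \<circ> q))"
    by (rule sum.mono_neutral_right) (use Y v F0 in auto)
  also have "\<dots> = (\<Sum>q\<in>T. F (transpose u v \<circ> q))"
  proof (simp, rule sum.mono_neutral_right)
    show "finite {q. q permutes S}" using Y by (simp add: finite_permutations)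
    show "T \<subseteq> {q. q permutes S}" unfolding T_def by (auto intro: permutes_subset)
    show "\<forall>q\<in>{q. q permutes S} - T. F (transpose u v \<circ> q) = 0"
    proof
      fix q assume "q \<in> {q. q permutes S} - T"
      hence q: "q permutes S" "\<not> q permutes S - {v}" by (auto simp: T_def)
      have "q v \<noteq> v"
      proof
        assume "q v = v"
        hence "q permutes S - {v}" using q(1) by (auto intro: permutes_superset)
        thus False using q by simp
      qed
      \<comment> \<open>If \<open>q\<close> moves \<open>v\<close>, the preimage \<open>i\<close> of
        \<open>v\<close> is sent to \<open>u\<close> by the composition, and the factor
        \<open>s i u\<close> is zero because \<open>v\<close> is the only neighbour of
        \<open>u\<close>.\<close>
      define i where "i = inv_into UNIV q v"
      have qi: "q i = v" using q(1) by (simp add: i_def permutes_inverses)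
      have i: "i \<in> S" "i \<noteq> v" using permutes_in_image[OF q(1), of i] v qi \<open>q v \<noteq> v\<close> by auto
      have "s i ((transpose u v \<circ> q) i) = s i u" using qi by simp
      also have "\<dots> = 0" using only[of i] i Y skew[of u i] by auto
      finally have "(\<Prod>i\<in>Y. s i ((transpose u v \<circ> q) i)) = 0"
        using assms(1) i(1) Y by (intro prod_zero) auto
      thus "F (transpose u v \<circ> q) = 0" by (simp add: F_def)
    qed
  qed
  also have "\<dots> = (\<Sum>q\<in>T. sign q * (\<Prod>i\<in>S - {v}. s i (q i)))"
  proof (rule sum.cong)
    fix q assume "q \<in> T"
    hence q: "q permutes S - {v}" by (simp add: T_def)
    have qu: "q u = u" "q v = v" using q Y by (auto simp: permutes_not_in)
    have "(\<Prod>i\<in>Y. s i ((transpose u v \<circ> q) i)) =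
       s u v * (s v u * (\<Prod>i\<in>S - {v}. s i ((transpose u v \<circ> q) i)))"
      using Y v qu by (simp add: prod.remove[of S v])
    also have "(\<Prod>i\<in>S - {v}. s i ((transpose u v \<circ> q) i)) = (\<Prod>i\<in>S - {v}. s i (q i))"
    proof (rule prod.cong)
      fix i assume i: "i \<in> S - {v}"
      hence "q i \<in> S - {v}" using q by (simp only: permutes_in_image)
      hence "q i \<noteq> u" "q i \<noteq> v" using Y by auto
      thus "s i ((transpose u v \<circ> q) i) = s i (q i)" by simp
    qed simp
    \<comment> \<open>The two entries multiply to \<open>-1\<close> by skewness, and the
      transposition contributes another \<open>-1\<close>; the signs cancel.\<close>
    also have "s u v * (s v u * (\<Prod>i\<in>S - {v}. s i (q i))) = - (\<Prod>i\<in>S - {v}. s i (q i))"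
      using s_square[OF v(2)] skew[of v u] by (simp add: mult.assoc[symmetric])
    finally have "(\<Prod>i\<in>Y. s i ((transpose u v \<circ> q) i)) = - (\<Prod>i\<in>S - {v}. s i (q i))" .
    moreover have "sign (transpose u v \<circ> q) = - sign q"
      using q Y v by (subst sign_compose)
        (auto simp: sign_swap_id permutation_swap_id intro: permutes_imp_permutation[of "S - {v}"])
    ultimately show "F (transpose u v \<circ> q) = sign q * (\<Prod>i\<in>S - {v}. s i (q i))"
      by (simp add: F_def)
  qed simp
  also have "\<dots> = minor (S - {v})" by (simp add: T_def minor_def)
  finally show ?thesis using S' by simp
qed

lemma minor_edge:
  assumes "u \<noteq> v"
  shows "minor {u, v} = (if s u v = 0 then 0 else 1)"
proof (cases "s u v = 0")
  case True
  have "minor {u, v} = 0" by (rule minor_isolated[of _ u]) (use True in \<open>auto simp: nbrs_def\<close>)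
  thus ?thesis using True by simp
next
  case False
  have "minor {u, v} = minor ({u, v} - {u, v})"
    by (rule minor_leaf) (use False in \<open>auto simp: nbrs_def\<close>)
  thus ?thesis using False by simp
qed

lemma minor_sum_0: "finite X \<Longrightarrow> minor_sum X 0 = 1"
proof -
  assume "finite X"
  hence "{Y. Y \<subseteq> X \<and> card Y = 2 * 0} = {{}}" by (auto dest: finite_subset)
  thus ?thesis by (simp add: minor_sum_def)
qed

lemma minor_sum_full: "finite X \<Longrightarrow> card X = 2 * j \<Longrightarrow> minor_sum X j = minor X"
proof -
  assume "finite X" "card X = 2 * j"
  hence "Y = X" if "Y \<subseteq> X" "card Y = 2 * j" for Y
    using card_subset_eq[OF _ that(1)] that(2) by simp
  hence "{Y. Y \<subseteq> X \<and> card Y = 2 * j} = {X}" using \<open>card X = 2 * j\<close> by auto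
  thus ?thesis by (simp add: minor_sum_def)
qed

lemma minor_sum_big: "finite X \<Longrightarrow> card X < 2 * j \<Longrightarrow> minor_sum X j = 0"
proof -
  assume "finite X" "card X < 2 * j"
  hence "{Y. Y \<subseteq> X \<and> card Y = 2 * j} = {}" by (auto dest: card_mono)
  thus ?thesis unfolding minor_sum_def by (simp only: sum.empty)
qed

lemma minor_sum_split:
  assumes "finite X" "u \<in> X"
  shows "minor_sum X j = minor_sum (X - {u}) j + (\<Sum>Y | Y \<subseteq> X \<and> card Y = 2 * j \<and> u \<in> Y. minor Y)"
proof -
  have "{Y. Y \<subseteq> X \<and> card Y = 2 * j} = {Y. Y \<subseteq> X - {u} \<and> card Y = 2 * j} \<union>
    {Y. Y \<subseteq> X \<and> card Y = 2 * j \<and> u \<in> Y}" by auto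
  thus ?thesis unfolding minor_sum_def
    by (simp only:, subst sum.union_disjoint) (use assms in \<open>auto intro: finite_subset[of _ "Pow X"]\<close>)
qed

lemma minor_sum_isolated:
  assumes "finite X" "u \<in> X" "nbrs X u = {}"
  shows "minor_sum X j = minor_sum (X - {u}) j"
proof -
  have "(\<Sum>Y | Y \<subseteq> X \<and> card Y = 2 * j \<and> u \<in> Y. minor Y) = 0"
  proof (rule sum.neutral, clarify)
    fix Y assume Y: "Y \<subseteq> X" "u \<in> Y"
    thus "minor Y = 0"
      using assms by (intro minor_isolated[of _ u]) (auto simp: nbrs_def dest: finite_subset)
  qed
  thus ?thesis using minor_sum_split[OF assms(1,2), of j] by simp
qed

text \<open>In a set that contains \<open>u\<close> but not \<open>v\<close> the vertex
  \<open>u\<close> is isolated and the minor vanishes; in a set that contains both, \<open>u\<close>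
  is a leaf and the pair can be removed.\<close>

lemma minor_sum_leaf:
  assumes "finite X" "u \<in> X" "nbrs X u = {v}"
  shows "minor_sum X (Suc j) = minor_sum (X - {u}) (Suc j) + minor_sum (X - {u, v}) j"
proof -
  have v: "v \<in> X" "v \<noteq> u" "s u v \<noteq> 0" using assms by (auto simp: nbrs_def)
  let ?A = "{Y. Y \<subseteq> X \<and> card Y = 2 * Suc j \<and> u \<in> Y}"
  let ?B = "{Y. Y \<subseteq> X \<and> card Y = 2 * Suc j \<and> u \<in> Y \<and> v \<in> Y}"
  have fin: "finite Y" if "Y \<subseteq> X" for Y using that assms(1) by (rule finite_subset)
  have "(\<Sum>Y\<in>?A. minor Y) = (\<Sum>Y\<in>?B. minor Y)"
  proof (rule sum.mono_neutral_right)
    show "finite ?A" using assms by (auto intro: finite_subset[of _ "Pow X"])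
    show "\<forall>Y\<in>?A - ?B. minor Y = 0"
    proof
      fix Y assume Y: "Y \<in> ?A - ?B"
      have "nbrs Y u \<subseteq> nbrs X u" using Y by (auto simp: nbrs_def)
      hence "nbrs Y u = {}" using Y assms(3) by (auto simp: nbrs_def)
      thus "minor Y = 0" using Y by (intro minor_isolated[of _ u] fin) auto
    qed
  qed auto
  also have "\<dots> = (\<Sum>Y | Y \<subseteq> X - {u, v} \<and> card Y = 2 * j. minor Y)"
  proof (rule sum.reindex_bij_witness[of _ "\<lambda>Y. insert u (insert v Y)" "\<lambda>Y. Y - {u, v}"])
    fix Y assume "Y \<in> {Y. Y \<subseteq> X - {u, v} \<and> card Y = 2 * j}"
    hence Y: "Y \<subseteq> X - {u, v}" "card Y = 2 * j" by auto
    have "finite Y" using Y fin[of Y] by auto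
    thus "insert u (insert v Y) \<in> ?B" using Y assms v by (auto simp: card_insert_if)
    show "insert u (insert v Y) - {u, v} = Y" using Y by auto
  next
    fix Y assume Y: "Y \<in> ?B"
    have fY: "finite Y" using Y fin[of Y] by auto
    have "card (Y - {u, v}) = card Y - card {u, v}"
      using Y fY by (intro card_Diff_subset) auto
    thus "Y - {u, v} \<in> {Y. Y \<subseteq> X - {u, v} \<and> card Y = 2 * j}" using Y v by auto
    show "insert u (insert v (Y - {u, v})) = Y" using Y by auto
    have "nbrs Y u = {v}" using Y assms(3) by (auto simp: nbrs_def)
    thus "minor (Y - {u, v}) = minor Y" using Y fY by (intro minor_leaf[symmetric]) auto
  qed
  finally show ?thesis using minor_sum_split[OF assms(1,2), of "Suc j"]
    by (simp add: minor_sum_def)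
qed

text \<open>Minors of order two are indicators of edges, so \<open>minor_sum X 1\<close> is the
  number of edges inside \<open>X\<close>. All later counting of edges is done in this form.\<close>

lemma minor_sum_1:
  assumes "finite X" "v \<in> X"
  shows "minor_sum X 1 = minor_sum (X - {v}) 1 + int (deg X v)"
proof -
  have "(\<Sum>Y | Y \<subseteq> X \<and> card Y = 2 * 1 \<and> v \<in> Y. minor Y) = (\<Sum>w\<in>X - {v}. minor {v, w})"
  proof (rule sum.reindex_bij_witness[of _ "\<lambda>w. {v, w}" "\<lambda>Y. the_elem (Y - {v})"])
    fix Y assume "Y \<in> {Y. Y \<subseteq> X \<and> card Y = 2 * 1 \<and> v \<in> Y}"
    hence Y: "Y \<subseteq> X" "card Y = 2" "v \<in> Y" by auto
    then obtain w where w: "Y = {v, w}" "w \<noteq> v"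
      by (metis card_2_iff insertE insert_commute singletonD)
    hence *: "Y - {v} = {w}" by auto
    show "{v, the_elem (Y - {v})} = Y" "the_elem (Y - {v}) \<in> X - {v}"
      "minor {v, the_elem (Y - {v})} = minor Y"
      unfolding * using w Y by auto
  next
    fix w assume w: "w \<in> X - {v}"
    hence "{v, w} - {v} = {w}" by auto
    thus "the_elem ({v, w} - {v}) = w" by simp
    show "{v, w} \<in> {Y. Y \<subseteq> X \<and> card Y = 2 * 1 \<and> v \<in> Y}" using w assms by (auto simp: card_insert_if)
  qed
  also have "\<dots> = (\<Sum>w\<in>X - {v}. if s v w = 0 then 0 else 1)"
    by (rule sum.cong) (auto simp: minor_edge)
  also have "\<dots> = (\<Sum>w\<in>nbrs X v. 1)"
    by (rule sum.mono_neutral_cong_right) (use assms in \<open>auto simp: nbrs_def\<close>)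
  finally show ?thesis using minor_sum_split[OF assms, of 1] by simp
qed

text \<open>Double counting: each set \<open>Y\<close> is counted once for every vertex outside it.\<close>

lemma minor_sum_vertex_deleted:
  assumes "finite X" "2 * j < card X"
  shows "int (card X - 2 * j) * minor_sum X j = (\<Sum>v\<in>X. minor_sum (X - {v}) j)"
proof -
  let ?A = "{Y. Y \<subseteq> X \<and> card Y = 2 * j}"
  have fA: "finite ?A" using assms by (auto intro: finite_subset[of _ "Pow X"])
  have "(\<Sum>v\<in>X. minor_sum (X - {v}) j) = (\<Sum>v\<in>X. \<Sum>Y\<in>?A. if v \<notin> Y then minor Y else 0)"
    unfolding minor_sum_def
    by (rule sum.cong[OF refl], rule sum.mono_neutral_cong_left) (use fA in auto)
  also have "\<dots> = (\<Sum>Y\<in>?A. \<Sum>v\<in>X. if v \<notin> Y then minor Y else 0)" by (rule sum.swap)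
  also have "\<dots> = (\<Sum>Y\<in>?A. int (card X - 2 * j) * minor Y)"
  proof (rule sum.cong)
    fix Y assume Y: "Y \<in> ?A"
    hence "(\<Sum>v\<in>X. if v \<notin> Y then minor Y else 0) = (\<Sum>v\<in>X - Y. minor Y)"
      by (intro sum.mono_neutral_cong_right) (use assms in auto)
    also have "\<dots> = int (card (X - Y)) * minor Y" by simp
    also have "card (X - Y) = card X - 2 * j"
      using Y assms by (auto simp: card_Diff_subset finite_subset)
    finally show "(\<Sum>v\<in>X. if v \<notin> Y then minor Y else 0) = int (card X - 2 * j) * minor Y" .
  qed simp
  finally show ?thesis by (simp add: minor_sum_def sum_distrib_left)
qed

end

section \<open>Graphs with at most one cycle\<close>

text \<open>
  \<open>path_count n j\<close> and \<open>cycle_count n j\<close> are the numbers of \<open>j\<close>-matchings of the path with \<open>n\<close>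
  and of the cycle with \<open>n + 2\<close> vertices. The values of \<open>extremal_count m\<close> are the coefficients of
  the characteristic polynomial of \<open>P\<^sub>n\<^sup>4\<close> with the orientation \<open>+\<close>, where \<open>n = m + 4\<close>.
\<close>

fun path_count :: "nat \<Rightarrow> nat \<Rightarrow> int" where
  "path_count n 0 = 1"
| "path_count 0 (Suc j) = 0"
| "path_count (Suc 0) (Suc j) = 0"
| "path_count (Suc (Suc n)) (Suc j) = path_count (Suc n) (Suc j) + path_count n j"

fun cycle_count :: "nat \<Rightarrow> nat \<Rightarrow> int" where
  "cycle_count n 0 = 1"
| "cycle_count n (Suc j) = path_count (Suc n) (Suc j) + 2 * path_count n j"

fun extremal_count :: "nat \<Rightarrow> nat \<Rightarrow> int" where
  "extremal_count m 0 = 1"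
| "extremal_count 0 (Suc j) = (if j \<le> 1 then 4 else 0)"
| "extremal_count (Suc 0) (Suc j) = (if j = 0 then 5 else if j = 1 then 6 else 0)"
| "extremal_count (Suc (Suc m)) (Suc j) = extremal_count (Suc m) (Suc j) + extremal_count m j"

lemma path_count_nonneg: "path_count n j \<ge> 0"
  by (induction n j rule: path_count.induct) auto

lemma path_count_Suc: "path_count n j \<le> path_count (Suc n) j"
  by (cases "(n, j)" rule: path_count.cases) (auto simp: path_count_nonneg)

lemma path_count_big: "n < 2 * j \<Longrightarrow> path_count n j = 0"
  by (induction n j rule: path_count.induct) auto

lemma path_count_1: "path_count (Suc n) (Suc 0) = int n"
  by (induction n) auto

lemma extremal_count_nonneg: "extremal_count m j \<ge> 0"
  by (induction m j rule: extremal_count.induct) auto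

lemma extremal_count_Suc: "extremal_count m j \<le> extremal_count (Suc m) j"
  by (cases "(m, j)" rule: extremal_count.cases) (auto simp: extremal_count_nonneg)

lemma extremal_count_1: "extremal_count m (Suc 0) = int m + 4"
  by (induction m "Suc 0" rule: extremal_count.induct) auto

text \<open>The constant \<open>4\<close> is the bound of \<open>regular_minor_le\<close> on the
  determinant of a whole cycle.\<close>

lemma extremal_count_full: "m + 4 = 2 * j \<Longrightarrow> extremal_count m j \<ge> 4"
proof (induction m j rule: extremal_count.induct)
  case (4 m j)
  thus ?case using extremal_count_nonneg[of "Suc m" "Suc j"] by auto
qed auto

lemma cycle_count_rec:
  "cycle_count (Suc (Suc n)) (Suc j) = cycle_count (Suc n) (Suc j) + cycle_count n j"
  by (cases j) auto

text \<open>Double counting for matchings of the cycle with \<open>n + 2\<close> vertices: a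
  \<open>j\<close>-matching misses \<open>n + 2 - 2 * j\<close> vertices, and deleting any one
  vertex leaves a path with \<open>n + 1\<close> vertices.\<close>

lemma cycle_count_path_count:
  "(int n + 2 - 2 * int j) * cycle_count n j = (int n + 2) * path_count (Suc n) j"
proof (induction n j rule: path_count.induct)
  case (2 j)
  thus ?case by (cases j) auto
next
  case (3 j)
  thus ?case by (cases j) (auto simp: path_count_big)
next
  case (4 n j)
  \<comment> \<open>The factor in the first summand is one less than the factor on the left; the
    last summand makes up for it.\<close>
  have "(int n + 4 - 2 * int (Suc j)) * cycle_count (Suc (Suc n)) (Suc j) =
    (int (Suc n) + 2 - 2 * int (Suc j)) * cycle_count (Suc n) (Suc j) +
    (int n + 2 - 2 * int j) * cycle_count n j + cycle_count (Suc n) (Suc j)"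
    unfolding cycle_count_rec by (simp add: algebra_simps del: cycle_count.simps)
  also have "\<dots> = (int n + 4) * path_count (Suc (Suc (Suc n))) (Suc j)"
    unfolding 4 by (simp add: algebra_simps)
  finally show ?case by (simp add: algebra_simps)
qed auto

text \<open>Both sides belong to \<open>m + 4\<close> vertices and satisfy the same recursion, so
  the cases \<open>m = 0\<close> and \<open>m = 1\<close> decide: \<open>1, 4, 2\<close> against
  \<open>1, 4, 4\<close> and \<open>1, 5, 5\<close> against \<open>1, 5, 6\<close>.\<close>

lemma cycle_count_le: "cycle_count (m + 2) j \<le> extremal_count m j"
proof (induction m j rule: extremal_count.induct)
  case (2 j)
  show ?case by (cases j; cases "j - 1") (auto simp: eval_nat_numeral path_count_big)
next
  case (3 j)
  show ?case by (cases j; cases "j - 1") (auto simp: eval_nat_numeral path_count_big)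
next
  case (4 m j)
  thus ?case using cycle_count_rec[of "m + 2" j] by simp
qed auto

text \<open>The coefficients with index \<open>1\<close> agree, so the recursion carries the strict
  inequalities \<open>2 < 4\<close> and \<open>5 < 6\<close> of the base cases along. This excludes
  cycles with more than four vertices from the case of equality.\<close>

lemma cycle_count_2_less: "cycle_count (m + 2) 2 < extremal_count m 2"
proof -
  have "cycle_count (m + 2) (Suc (Suc 0)) < extremal_count m (Suc (Suc 0))"
  proof (induction m rule: induct_nat_012)
    case (ge2 m)
    have "cycle_count (m + 2) (Suc 0) = extremal_count m (Suc 0)"
      by (simp add: path_count_1 extremal_count_1)
    thus ?case using ge2 cycle_count_rec[of "m + 2" "Suc 0"] by simp
  qed (auto simp: eval_nat_numeral)
  thus ?thesis by (simp add: eval_nat_numeral)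
qed

section \<open>Coefficient bounds for forests, cycles and graphs with at most one cycle\<close>

context skew_form
begin

text \<open>Degeneracy takes the place of the absence of cycles: an induced subgraph of minimum
  degree two would contain a cycle, and the vertex provided here is the one that the leaf recursion
  deletes.\<close>

definition is_forest :: "'a set \<Rightarrow> bool" where
  "is_forest X \<longleftrightarrow> (\<forall>Y\<subseteq>X. Y \<noteq> {} \<longrightarrow> (\<exists>u\<in>Y. deg Y u < 2))"

text \<open>
  \<open>At most one cycle\<close> in a form that passes to subsets: all subgraphs of minimum degree two are \<open>2\<close>-regular and no two of
  them are disjoint.
\<close>

definition near_forest :: "'a set \<Rightarrow> bool" where
  "near_forest X \<longleftrightarrow>
     (\<forall>Y\<subseteq>X. (\<forall>u\<in>Y. 2 \<le> deg Y u) \<longrightarrow> (\<forall>u\<in>Y. deg Y u = 2)) \<and>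
     (\<forall>Y\<subseteq>X. \<forall>Z\<subseteq>X. Y \<noteq> {} \<and> Z \<noteq> {} \<and> Y \<inter> Z = {} \<longrightarrow>
        (\<exists>u\<in>Y. deg Y u < 2) \<or> (\<exists>u\<in>Z. deg Z u < 2))"

lemma is_forest_subset: "is_forest X \<Longrightarrow> Y \<subseteq> X \<Longrightarrow> is_forest Y"
  unfolding is_forest_def by blast

lemma near_forest_subset: "near_forest X \<Longrightarrow> Y \<subseteq> X \<Longrightarrow> near_forest Y"
  unfolding near_forest_def by (meson subset_trans)

lemma finite_nbrs: "finite X \<Longrightarrow> finite (nbrs X u)"
  by (simp add: nbrs_def)

lemma nbrs_mono: "Y \<subseteq> X \<Longrightarrow> nbrs Y u \<subseteq> nbrs X u"
  by (auto simp: nbrs_def)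

lemma deg_less_2_cases:
  assumes "finite X" "deg X u < 2"
  obtains "nbrs X u = {}" | v where "nbrs X u = {v}"
proof -
  have "deg X u = 0 \<or> deg X u = Suc 0" using assms by linarith
  thus ?thesis using that finite_nbrs[OF assms(1), of u] by (auto simp: card_1_singleton_iff)
qed

text \<open>\<open>path_count\<close> satisfies the leaf recursion with equality and grows with the
  number of vertices, so deleting a leaf or an isolated vertex compares every forest with the
  path.\<close>

lemma forest_minor_sum_le:
  assumes "finite X" "is_forest X"
  shows "\<bar>minor_sum X j\<bar> \<le> path_count (card X) j"
  using assms
proof (induction "card X" arbitrary: X j rule: less_induct)
  case less
  show ?case
  proof (cases j)
    case 0
    thus ?thesis using less.prems by (simp add: minor_sum_0)
  next
    case j: (Suc i)
    show ?thesis
    proof (cases "X = {}")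
      case True
      thus ?thesis using j by (simp add: minor_sum_big)
    next
      case False
      then obtain u where u: "u \<in> X" "deg X u < 2"
        using less.prems unfolding is_forest_def by blast
      have IH: "\<bar>minor_sum Y k\<bar> \<le> path_count (card Y) k" if "Y \<subset> X" for Y k
        using that less.prems
        by (intro less.hyps psubset_card_mono) (auto intro: is_forest_subset finite_subset)
      have cu: "card X = Suc (card (X - {u}))"
        using u less.prems by (metis card_Suc_Diff1)
      have IHu: "\<bar>minor_sum (X - {u}) k\<bar> \<le> path_count (card (X - {u})) k" for k
        using u by (intro IH) auto
      show ?thesis
      proof (cases rule: deg_less_2_cases[OF less.prems(1) u(2)])
        case 1
        have "path_count (card (X - {u})) j \<le> path_count (card X) j"
          unfolding cu by (rule path_count_Suc)
        thus ?thesis using minor_sum_isolated[OF less.prems(1) u(1) 1, of j] IHu[of j] by linarith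
      next
        case (2 v)
        have v: "v \<in> X - {u}" using 2 by (auto simp: nbrs_def)
        have "card (X - {u}) = Suc (card (X - {u} - {v}))"
          using v less.prems by (metis card_Suc_Diff1 finite_Diff)
        moreover have "X - {u} - {v} = X - {u, v}" by auto
        ultimately have cv: "card (X - {u}) = Suc (card (X - {u, v}))" by simp
        have "\<bar>minor_sum (X - {u, v}) i\<bar> \<le> path_count (card (X - {u, v})) i"
          using u by (intro IH) auto
        thus ?thesis using minor_sum_leaf[OF less.prems(1) u(1) 2, of i] IHu[of j] cu cv j by simp
      qed
    qed
  qed
qed

lemma near_forest_cases [consumes 2, case_names isolated leaf regular]:
  assumes "finite X" "near_forest X"
  obtains u where "u \<in> X" "nbrs X u = {}"
  | u v where "u \<in> X" "nbrs X u = {v}"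
  | "\<And>u. u \<in> X \<Longrightarrow> deg X u = 2"
proof (cases "\<forall>u\<in>X. 2 \<le> deg X u")
  case True
  thus ?thesis using assms(2) that(3) unfolding near_forest_def by (metis order_refl)
next
  case False
  then obtain u where "u \<in> X" "deg X u < 2" by auto
  thus ?thesis using that(1,2) deg_less_2_cases[OF assms(1)] by metis
qed

context
  fixes X
  assumes fin: "finite X" and nf: "near_forest X"
    and regular: "\<And>u. u \<in> X \<Longrightarrow> deg X u = 2"
begin

text \<open>A union of components and its complement would be two disjoint subgraphs of minimum
  degree two. So a regular near-forest is connected, that is, a single cycle.\<close>

lemma regular_closed_subset:
  assumes "Z \<subseteq> X" "Z \<noteq> {}" "\<And>u. u \<in> Z \<Longrightarrow> nbrs X u \<subseteq> Z"
  shows "Z = X"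
proof (rule ccontr)
  assume "Z \<noteq> X"
  hence ne: "X - Z \<noteq> {}" using assms(1) by auto
  have "nbrs Z u = nbrs X u" if "u \<in> Z" for u
    using assms(1) assms(3)[OF that] by (auto simp: nbrs_def)
  moreover have "nbrs (X - Z) u = nbrs X u" if "u \<in> X - Z" for u
  proof -
    have "v \<notin> Z" if v: "v \<in> nbrs X u" for v
    proof
      assume "v \<in> Z"
      moreover have "u \<in> nbrs X v" using v \<open>u \<in> X - Z\<close> s_sym_nz by (auto simp: nbrs_def)
      ultimately show False using assms(3) \<open>u \<in> X - Z\<close> by auto
    qed
    thus ?thesis by (auto simp: nbrs_def)
  qed
  ultimately have "\<not> ((\<exists>u\<in>Z. deg Z u < 2) \<or> (\<exists>u\<in>X - Z. deg (X - Z) u < 2))"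
    using regular assms(1) by (auto simp: subset_iff)
  moreover have "Z \<inter> (X - Z) = {}" "X - Z \<subseteq> X" by auto
  ultimately show False using nf assms(1,2) ne unfolding near_forest_def by meson
qed

text \<open>A subgraph of minimum degree two keeps all neighbours of its vertices, so by
  connectedness it is the whole cycle and contains \<open>v\<close>.\<close>

lemma regular_delete_is_forest:
  assumes "v \<in> X"
  shows "is_forest (X - {v})"
  unfolding is_forest_def
proof (intro allI impI, rule ccontr)
  fix Y assume Y: "Y \<subseteq> X - {v}" "Y \<noteq> {}" "\<not> (\<exists>u\<in>Y. deg Y u < 2)"
  have "nbrs X u \<subseteq> Y" if "u \<in> Y" for u
  proof -
    have sub: "nbrs Y u \<subseteq> nbrs X u" using Y by (intro nbrs_mono) auto
    have "deg X u \<le> deg Y u" using Y that regular[of u] by (auto simp: not_less)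
    hence "nbrs Y u = nbrs X u" using sub fin by (simp add: card_seteq finite_nbrs)
    thus ?thesis by (auto simp: nbrs_def)
  qed
  hence "Y = X" using Y by (intro regular_closed_subset) auto
  thus False using Y assms by auto
qed

text \<open>
  A permutation moving every vertex along an edge of the cycle is determined by the image and
  the preimage of a single vertex, for each of which there are two choices.
\<close>

lemma regular_minor_le: "\<bar>minor X\<bar> \<le> 4"
proof (cases "X = {}")
  case False
  then obtain a where a: "a \<in> X" by auto
  define P where "P = {\<pi>. \<pi> permutes X \<and> (\<forall>i\<in>X. s i (\<pi> i) \<noteq> 0)}"
  define g where "g \<pi> = (\<pi> a, inv_into UNIV \<pi> a)" for \<pi> :: "'a \<Rightarrow> 'a"
  have "finite {\<pi>. \<pi> permutes X}" using fin by (rule finite_permutations)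
  moreover have P: "P \<subseteq> {\<pi>. \<pi> permutes X}" by (auto simp: P_def)
  ultimately have finP: "finite P" and finX: "finite {\<pi>. \<pi> permutes X}" by (auto dest: finite_subset)
  have sub: "g ` P \<subseteq> nbrs X a \<times> nbrs X a"
  proof (clarsimp simp: g_def)
    fix \<pi> assume \<pi>: "\<pi> \<in> P"
    hence p: "\<pi> permutes X" by (simp add: P_def)
    let ?b = "inv_into UNIV \<pi> a"
    have b: "\<pi> ?b = a" using p by (simp add: permutes_inverses)
    hence "?b \<in> X" using permutes_in_image[OF p, of ?b] a by simp
    hence "s ?b (\<pi> ?b) \<noteq> 0" using \<pi> unfolding P_def by blast
    hence "s a ?b \<noteq> 0" using b s_sym_nz[of ?b a] by simp
    thus "\<pi> a \<in> nbrs X a \<and> ?b \<in> nbrs X a"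
      using \<pi> a \<open>?b \<in> X\<close> permutes_in_image[OF p] by (auto simp: P_def nbrs_def)
  qed
  have inj: "inj_on g P"
  proof (rule inj_onI)
    fix \<pi> \<sigma> assume *: "\<pi> \<in> P" "\<sigma> \<in> P" "g \<pi> = g \<sigma>"
    hence p: "\<pi> permutes X" and q: "\<sigma> permutes X" by (auto simp: P_def)
    let ?p' = "inv_into UNIV \<pi>" and ?q' = "inv_into UNIV \<sigma>"
    \<comment> \<open>Agreement in both image and preimage at \<open>i\<close> tells whether a
      neighbour \<open>j\<close> is mapped to \<open>i\<close> or comes from \<open>i\<close>. As
      \<open>j\<close> has only two neighbours, this forces agreement at \<open>j\<close> too, so it
      spreads from \<open>a\<close> around the cycle.\<close>
    define Z where "Z = {i \<in> X. \<pi> i = \<sigma> i \<and> ?p' i = ?q' i}"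
    have nb: "\<pi> i \<in> nbrs X i" "\<sigma> i \<in> nbrs X i" "?p' i \<in> nbrs X i" "?q' i \<in> nbrs X i"
      if i: "i \<in> X" for i
    proof -
      show "\<pi> i \<in> nbrs X i" "\<sigma> i \<in> nbrs X i"
        using * i permutes_in_image[OF p, of i] permutes_in_image[OF q, of i] by (auto simp: P_def nbrs_def)
      have pi: "\<pi> (?p' i) = i" "\<sigma> (?q' i) = i" using p q by (auto simp: permutes_inverses)
      hence X: "?p' i \<in> X" "?q' i \<in> X"
        using i permutes_in_image[OF p, of "?p' i"] permutes_in_image[OF q, of "?q' i"] by auto
      hence "s (?p' i) (\<pi> (?p' i)) \<noteq> 0" "s (?q' i) (\<sigma> (?q' i)) \<noteq> 0"
        using * unfolding P_def by blast+
      hence "s (?p' i) i \<noteq> 0" "s (?q' i) i \<noteq> 0" using pi by simp_all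
      thus "?p' i \<in> nbrs X i" "?q' i \<in> nbrs X i" using X s_sym_nz by (auto simp: nbrs_def)
    qed
    have two: "x = y" if A: "x \<in> nbrs X j" "y \<in> nbrs X j" "i \<in> nbrs X j" "x = i \<longleftrightarrow> y = i" "j \<in> X"
      for x y i j
    proof -
      obtain b c where bc: "nbrs X j = {b, c}" using regular[OF A(5)] by (auto simp: card_2_iff)
      show ?thesis using A unfolding bc by auto
    qed
    have "Z = X"
    proof (rule regular_closed_subset)
      show "Z \<noteq> {}" using a *(3) by (auto simp: Z_def g_def)
      fix i assume i: "i \<in> Z"
      show "nbrs X i \<subseteq> Z"
      proof
        fix j assume j: "j \<in> nbrs X i"
        have iX: "i \<in> X" and jX: "j \<in> X" and ij: "i \<in> nbrs X j"
          using i j s_sym_nz by (auto simp: Z_def nbrs_def)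
        have e: "\<pi> i = \<sigma> i" "?p' i = ?q' i" using i by (auto simp: Z_def)
        have "\<pi> j = i \<longleftrightarrow> \<sigma> j = i"
          using e(2) permutes_inv_eq[OF p, of i j] permutes_inv_eq[OF q, of i j] by auto
        hence 1: "\<pi> j = \<sigma> j" using two[OF nb(1,2)[OF jX] ij _ jX] by simp
        have "?p' j = i \<longleftrightarrow> ?q' j = i"
          using e(1) permutes_inv_eq[OF p, of j i] permutes_inv_eq[OF q, of j i] by auto
        hence "?p' j = ?q' j" using two[OF nb(3,4)[OF jX] ij _ jX] by simp
        thus "j \<in> Z" using 1 jX by (simp add: Z_def)
      qed
    qed (auto simp: Z_def)
    hence "\<pi> i = \<sigma> i" if "i \<in> X" for i using that by (auto simp: Z_def)
    moreover have "\<pi> i = \<sigma> i" if "i \<notin> X" for i using that p q by (simp add: permutes_not_in)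
    ultimately show "\<pi> = \<sigma>" by blast
  qed
  have "card P \<le> card (nbrs X a \<times> nbrs X a)"
    using sub inj fin by (auto intro!: card_inj_on_le[of g] finite_cartesian_product finite_nbrs)
  also have "\<dots> = 4" using regular[OF a] by (simp add: card_cartesian_product)
  finally have cP: "card P \<le> 4" .
  have prod1: "\<bar>\<Prod>i\<in>X. s i (\<pi> i)\<bar> \<le> 1" for \<pi>
    unfolding abs_prod by (rule prod_le_1) (use abs_le_1 in auto)
  have "minor X = (\<Sum>\<pi>\<in>P. sign \<pi> * (\<Prod>i\<in>X. s i (\<pi> i)))"
    unfolding minor_def
  proof (rule sum.mono_neutral_right[OF finX P], rule ballI)
    fix \<pi> assume "\<pi> \<in> {\<pi>. \<pi> permutes X} - P"
    then obtain i where "i \<in> X" "s i (\<pi> i) = 0" by (auto simp: P_def)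
    hence "(\<Prod>i\<in>X. s i (\<pi> i)) = 0" using fin by (meson prod_zero)
    thus "sign \<pi> * (\<Prod>i\<in>X. s i (\<pi> i)) = 0" by simp
  qed
  also have "\<bar>\<dots>\<bar> \<le> (\<Sum>\<pi>\<in>P. \<bar>sign \<pi> * (\<Prod>i\<in>X. s i (\<pi> i))\<bar>)" by (rule sum_abs)
  also have "\<dots> \<le> (\<Sum>\<pi>\<in>P. 1)"
    by (rule sum_mono) (use prod1 in \<open>simp add: abs_mult\<close>)
  also have "\<dots> \<le> 4" using cP by simp
  finally show ?thesis .
qed simp

text \<open>Each vertex-deleted subgraph is a forest with \<open>m + 3\<close> vertices, and by
  \<open>cycle_count_path_count\<close> the bounds for these add up to exactly a multiple of the
  matching number of the cycle. The strict inequality permits cancelling the factor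
  \<open>card X - 2 * j\<close>.\<close>

lemma regular_minor_sum_le:
  assumes "2 * j < card X" "card X = m + 4"
  shows "\<bar>minor_sum X j\<bar> \<le> cycle_count (m + 2) j"
proof -
  have "int (card X - 2 * j) * \<bar>minor_sum X j\<bar> = \<bar>\<Sum>v\<in>X. minor_sum (X - {v}) j\<bar>"
    using arg_cong[OF minor_sum_vertex_deleted[OF fin assms(1)], of abs] by (simp add: abs_mult)
  also have "\<dots> \<le> (\<Sum>v\<in>X. \<bar>minor_sum (X - {v}) j\<bar>)" by (rule sum_abs)
  also have "\<dots> \<le> (\<Sum>v\<in>X. path_count (Suc (m + 2)) j)"
  proof (rule sum_mono)
    fix v assume v: "v \<in> X"
    have "card (X - {v}) = Suc (m + 2)" using v assms fin by simp
    thus "\<bar>minor_sum (X - {v}) j\<bar> \<le> path_count (Suc (m + 2)) j"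
      using forest_minor_sum_le[OF _ regular_delete_is_forest[OF v], of j] fin by simp
  qed
  also have "\<dots> = (int (m + 2) + 2) * path_count (Suc (m + 2)) j" using assms by simp
  also have "\<dots> = (int (m + 2) + 2 - 2 * int j) * cycle_count (m + 2) j"
    by (rule cycle_count_path_count[symmetric])
  also have "\<dots> = int (card X - 2 * j) * cycle_count (m + 2) j"
    using assms by (simp add: of_nat_diff)
  finally show ?thesis using assms by (simp add: mult_le_cancel_left)
qed

end

lemma minor_sum_1_nonneg: "minor_sum X 1 \<ge> 0"
  unfolding minor_sum_def
proof (rule sum_nonneg)
  fix Y assume "Y \<in> {Y. Y \<subseteq> X \<and> card Y = 2 * 1}"
  hence "card Y = 2" by simp
  then obtain u v where "Y = {u, v}" "u \<noteq> v" by (auto simp: card_2_iff)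
  thus "minor Y \<ge> 0" by (simp add: minor_edge)
qed

lemma regular_card_ge_3:
  assumes "finite X" "u \<in> X" "deg X u = 2"
  shows "card X \<ge> 3"
proof -
  have "nbrs X u \<subseteq> X - {u}" by (auto simp: nbrs_def)
  hence "2 \<le> card (X - {u})" using assms card_mono[of "X - {u}" "nbrs X u"] by simp
  thus ?thesis using assms by simp
qed

text \<open>Deleting a vertex of degree below two loses at most one edge. In a cycle every
  vertex-deleted forest has at most \<open>card X - 2\<close> edges, and double counting turns this
  into the bound.\<close>

lemma minor_sum_1_le:
  assumes "finite X" "near_forest X"
  shows "minor_sum X 1 \<le> int (card X)"
  using assms
proof (induction "card X" arbitrary: X rule: less_induct)
  case less
  have del: ?case if "u \<in> X" "deg X u < 2" for u
  proof -
    have "card (X - {u}) < card X" using less.prems that by (intro psubset_card_mono) auto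
    hence "minor_sum (X - {u}) 1 \<le> int (card (X - {u}))"
      using less.prems by (intro less.hyps) (auto intro: near_forest_subset)
    moreover have "card X = Suc (card (X - {u}))" using less.prems that by (metis card_Suc_Diff1)
    ultimately show ?thesis using minor_sum_1[OF less.prems(1) that(1)] that by linarith
  qed
  show ?case
  using less.prems
  proof (cases rule: near_forest_cases)
    case (isolated u)
    thus ?thesis by (intro del[of u]) auto
  next
    case (leaf u v)
    thus ?thesis by (intro del[of u]) auto
  next
    case regular
    show ?thesis
    proof (cases "X = {}")
      case True
      thus ?thesis using minor_sum_big[of X 1] by simp
    next
      case False
      then obtain u where "u \<in> X" by auto
      hence c: "card X \<ge> 3" using regular_card_ge_3 less.prems regular by blast
      have "int (card X - 2 * 1) * minor_sum X 1 = (\<Sum>v\<in>X. minor_sum (X - {v}) 1)"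
        using c less.prems by (intro minor_sum_vertex_deleted) auto
      also have "\<dots> \<le> (\<Sum>v\<in>X. int (card X - 2))"
      proof (rule sum_mono)
        fix v assume v: "v \<in> X"
        have "card (X - {v}) = Suc (card X - 2)" using v c less.prems by simp
        thus "minor_sum (X - {v}) 1 \<le> int (card X - 2)"
          using forest_minor_sum_le[OF _ regular_delete_is_forest[OF less.prems regular v], of 1]
            less.prems path_count_1[of "card X - 2"] by simp
      qed
      also have "\<dots> = int (card X - 2) * int (card X)" by simp
      finally show ?thesis using c by (simp add: mult_le_cancel_left)
    qed
  qed
qed

text \<open>On three vertices the coefficient with \<open>j = 2\<close> vanishes, so only the edges
  on the two vertices other than \<open>u\<close> and \<open>v\<close> count. Hence on four vertices
  the value \<open>4\<close> requires a cycle.\<close>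

lemma minor_sum_4_leaf_le:
  assumes "finite X" "near_forest X" "card X = 4" "u \<in> X" "deg X u < 2"
  shows "\<bar>minor_sum X 2\<bar> \<le> 2"
proof (cases rule: deg_less_2_cases[OF assms(1,5)])
  case 1
  thus ?thesis using minor_sum_isolated[OF assms(1,4), of 2] minor_sum_big[of "X - {u}" 2] assms by simp
next
  case (2 v)
  have v: "v \<in> X" "v \<noteq> u" using 2 by (auto simp: nbrs_def)
  have "card (X - {u, v}) = 2" using v assms by (simp add: card_Diff_subset)
  moreover have "near_forest (X - {u, v})" using assms by (auto intro: near_forest_subset)
  ultimately have "minor_sum (X - {u, v}) 1 \<le> 2"
    using minor_sum_1_le[of "X - {u, v}"] assms by simp
  moreover have "minor_sum X (Suc 1) = minor_sum (X - {u}) (Suc 1) + minor_sum (X - {u, v}) 1"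
    by (rule minor_sum_leaf[OF assms(1,4) 2])
  moreover have "minor_sum (X - {u}) (Suc 1) = 0" using assms by (intro minor_sum_big) auto
  ultimately show ?thesis using minor_sum_1_nonneg[of "X - {u, v}"] by (simp add: numeral_2_eq_2)
qed

lemma minor_sum_4_le:
  assumes "finite X" "near_forest X" "card X = 4"
  shows "\<bar>minor_sum X 2\<bar> \<le> 4"
  using assms(1,2)
proof (cases rule: near_forest_cases)
  case (isolated u)
  thus ?thesis using minor_sum_4_leaf_le[OF assms, of u] by simp
next
  case (leaf u v)
  thus ?thesis using minor_sum_4_leaf_le[OF assms, of u] by simp
next
  case regular
  thus ?thesis using regular_minor_le[OF assms(1,2)] minor_sum_full[of X 2] assms by simp
qed

text \<open>The last conclusion is the trade-off behind the five-vertex bound and the case of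
  equality: edges at \<open>v\<close> are missing from \<open>X - {u, v}\<close>, so a large second
  term of the leaf recursion leaves \<open>v\<close> few neighbours.\<close>

lemma near_forest_minor_sum_leaf:
  assumes "finite X" "near_forest X" "u \<in> X" "nbrs X u = {v}" "card X = Suc (Suc k)"
  shows "v \<in> X" "v \<noteq> u" "near_forest (X - {u})" "near_forest (X - {u, v})"
    "card (X - {u}) = Suc k" "card (X - {u, v}) = k"
    "deg (X - {u}) v + minor_sum (X - {u, v}) 1 \<le> Suc k"
proof -
  show v: "v \<in> X" "v \<noteq> u" using assms by (auto simp: nbrs_def)
  show nf: "near_forest (X - {u})" "near_forest (X - {u, v})"
    using assms by (auto intro: near_forest_subset)
  show c: "card (X - {u}) = Suc k" "card (X - {u, v}) = k"
    using assms v by (auto simp: card_Diff_subset)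
  have "X - {u} - {v} = X - {u, v}" by auto
  hence "minor_sum (X - {u}) 1 = minor_sum (X - {u, v}) 1 + int (deg (X - {u}) v)"
    using minor_sum_1[of "X - {u}" v] v assms by simp
  thus "deg (X - {u}) v + minor_sum (X - {u, v}) 1 \<le> Suc k"
    using minor_sum_1_le[of "X - {u}"] nf c assms by simp
qed

text \<open>If the second term of the recursion exceeds \<open>2\<close>, the trade-off leaves
  \<open>v\<close> at most one neighbour in \<open>X - {u}\<close>, and the first term drops from
  \<open>4\<close> to \<open>2\<close>. So the total is at most \<open>4 + 2\<close> or
  \<open>2 + 3\<close>, and \<open>6\<close> needs the former.\<close>

lemma minor_sum_5_leaf:
  assumes "finite X" "near_forest X" "card X = 5" "u \<in> X" "nbrs X u = {v}"
  shows "\<bar>minor_sum X 2\<bar> \<le> 6"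
    "\<bar>minor_sum X 2\<bar> = 6 \<Longrightarrow> \<bar>minor_sum (X - {u}) 2\<bar> = 4"
proof -
  note * = near_forest_minor_sum_leaf[OF assms(1,2,4,5), of 3]
  have rec: "minor_sum X 2 = minor_sum (X - {u}) 2 + minor_sum (X - {u, v}) 1"
    using minor_sum_leaf[OF assms(1,4,5), of 1] by (simp add: numeral_2_eq_2)
  have nn: "minor_sum (X - {u, v}) 1 \<ge> 0" by (rule minor_sum_1_nonneg)
  have a: "\<bar>minor_sum (X - {u}) 2\<bar> \<le> 4" using * assms by (intro minor_sum_4_le) auto
  have b: "\<bar>minor_sum (X - {u}) 2\<bar> \<le> 2" if "minor_sum (X - {u, v}) 1 > 2"
    by (rule minor_sum_4_leaf_le[of _ v]) (use * assms that in auto)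
  have c: "minor_sum (X - {u, v}) 1 \<le> 3" using minor_sum_1_le[of "X - {u, v}"] * assms by simp
  show "\<bar>minor_sum X 2\<bar> \<le> 6"
    "\<bar>minor_sum X 2\<bar> = 6 \<Longrightarrow> \<bar>minor_sum (X - {u}) 2\<bar> = 4"
    using rec nn a b c by linarith+
qed

lemma near_forest_minor_sum_le:
  assumes "finite X" "near_forest X" "card X = m + 4"
  shows "\<bar>minor_sum X j\<bar> \<le> extremal_count m j"
  using assms
proof (induction m arbitrary: X j rule: less_induct)
  case (less m)
  note fin = less.prems(1) and nf = less.prems(2) and card = less.prems(3)
  have one: ?case if "j = Suc 0"
    using minor_sum_1_le[OF fin nf] minor_sum_1_nonneg[of X] card that
    by (simp add: extremal_count_1)
  have big: ?case if "card X < 2 * j"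
    using minor_sum_big[OF fin that] extremal_count_nonneg[of m j] by simp
  consider "j = 0" | "j = Suc 0" | "card X < 2 * j" | "j \<ge> 2" "2 * j \<le> card X" by linarith
  thus ?case
  proof cases
    case 1
    thus ?thesis using fin by (simp add: minor_sum_0)
  next
    case 4
    then obtain i where i: "j = Suc i" by (cases j) auto
    show ?thesis
    using fin nf
    proof (cases rule: near_forest_cases)
      case regular
      show ?thesis
      \<comment> \<open>For the full coefficient the factor in the double counting is zero; the
        determinant bound replaces it.\<close>
      proof (cases "2 * j = card X")
        case True
        thus ?thesis using regular_minor_le[OF fin nf regular] minor_sum_full[OF fin, of j]
            extremal_count_full[of m j] card by simp
      next
        case False
        thus ?thesis using regular_minor_sum_le[OF fin nf regular, of j m] cycle_count_le[of m j]
            4 card by linarith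
      qed
    next
      case (isolated u)
      have c: "card (X - {u}) = m + 3" using isolated fin card by simp
      note rec = minor_sum_isolated[OF fin isolated, of j]
      show ?thesis
      proof (cases m)
        case 0
        thus ?thesis using rec minor_sum_big[of "X - {u}" j] 4 c fin extremal_count_nonneg[of m j]
          by simp
      next
        case (Suc k)
        have "\<bar>minor_sum (X - {u}) j\<bar> \<le> extremal_count k j"
          using Suc fin nf c by (intro less.IH) (auto intro: near_forest_subset)
        thus ?thesis using rec extremal_count_Suc[of k j] Suc by simp
      qed
    next
      case (leaf u v)
      note * = near_forest_minor_sum_leaf[OF fin nf leaf, of "m + 2"]
      \<comment> \<open>For \<open>m < 2\<close> the set \<open>X - {u, v}\<close> has fewer than
        four vertices and the induction hypothesis does not reach it.\<close>
      consider "m = 0" | "m = 1" | k where "m = Suc (Suc k)" by (cases m; cases "m - 1") auto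
      thus ?thesis
      proof cases
        case 1
        hence "j = 2" using 4 card by simp
        thus ?thesis using minor_sum_4_le[OF fin nf] 1 card by (simp add: numeral_2_eq_2)
      next
        case 2
        hence "j = 2" using 4 card by simp
        thus ?thesis using minor_sum_5_leaf(1)[OF fin nf _ leaf] 2 card by (simp add: numeral_2_eq_2)
      next
        case (3 k)
        have "\<bar>minor_sum (X - {u}) j\<bar> \<le> extremal_count (Suc k) j"
          using 3 fin * card by (intro less.IH) auto
        moreover have "\<bar>minor_sum (X - {u, v}) i\<bar> \<le> extremal_count k i"
          using 3 fin * card by (intro less.IH) auto
        ultimately show ?thesis using minor_sum_leaf[OF fin leaf, of i] 3 i by simp
      qed
    qed
  qed (use one big in auto)
qed

end

section \<open>The extremal graph\<close>

text \<open>The graphs \<open>P\<^sub>n\<^sup>4\<close> are the subgraphs of one infinite graph induced on \<open>{..<n}\<close>.\<close>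

definition extremal_arc :: "nat \<Rightarrow> nat \<Rightarrow> bool" where
  "extremal_arc i j \<longleftrightarrow> i < 4 \<and> j = Suc i mod 4 \<or> i = 0 \<and> j = 4 \<or> 4 \<le> i \<and> j = Suc i"

definition extremal_adj :: "nat \<Rightarrow> nat \<Rightarrow> bool" where
  "extremal_adj i j \<longleftrightarrow> extremal_arc i j \<or> extremal_arc j i"

lemma less_4_iff: "(i::nat) < 4 \<longleftrightarrow> i = 0 \<or> i = 1 \<or> i = 2 \<or> i = 3"
  by linarith

lemma extremal_adj_less_4:
  assumes "i < 4" "j < 4"
  shows "extremal_adj i j \<longleftrightarrow> (i, j) \<in> {(0,1), (1,2), (2,3), (3,0), (1,0), (2,1), (3,2), (0,3)}"
  using assms unfolding less_4_iff by (elim disjE) (simp_all add: extremal_adj_def extremal_arc_def)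

text \<open>The vertex \<open>4\<close> hangs from the cycle vertex \<open>0\<close>, every later
  one from its predecessor; hence the case distinction that recurs below.\<close>

lemma extremal_adj_new:
  "i < m + 4 \<Longrightarrow> extremal_adj (m + 4) i \<longleftrightarrow> i = (if m = 0 then 0 else m + 3)"
  "i < m + 4 \<Longrightarrow> extremal_adj i (m + 4) \<longleftrightarrow> i = (if m = 0 then 0 else m + 3)"
  by (auto simp: extremal_adj_def extremal_arc_def)

lemma not_extremal_adj_self: "\<not> extremal_adj i i"
  by (cases "i < 4") (auto simp: less_4_iff extremal_adj_def extremal_arc_def)

text \<open>Since all vertices but the last have two neighbours, a degree below two identifies the
  end of the path, the only place where the next leaf may be attached.\<close>

lemma extremal_adj_two:
  assumes "i < m + 3" "m > 0"
  obtains a b where "a < m + 4" "b < m + 4" "a \<noteq> b" "extremal_adj i a" "extremal_adj i b"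
proof (cases "i < 4")
  case True
  have "extremal_adj i (Suc i mod 4)" "extremal_adj i ((i + 3) mod 4)" "Suc i mod 4 \<noteq> (i + 3) mod 4"
    "Suc i mod 4 < m + 4" "(i + 3) mod 4 < m + 4"
    using True unfolding less_4_iff by (elim disjE; simp add: extremal_adj_def extremal_arc_def)+
  thus ?thesis using that by blast
next
  case False
  have a: "extremal_adj i (Suc i)" "extremal_adj i (if i = 4 then 0 else i - 1)"
    using False by (auto simp: extremal_adj_def extremal_arc_def)
  show ?thesis by (rule that[OF _ _ _ a]) (use False assms in auto)
qed

section \<open>Labellings by the extremal graph and the case of equality\<close>

context skew_form
begin

text \<open>The sign condition says that an odd number of arcs of the four-cycle point backwards.\<close>

definition extremal_labelling :: "(nat \<Rightarrow> 'a) \<Rightarrow> 'a set \<Rightarrow> nat \<Rightarrow> bool" where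
  "extremal_labelling f X m \<longleftrightarrow> bij_betw f {..<m + 4} X \<and>
     (\<forall>i<m + 4. \<forall>j<m + 4. s (f i) (f j) \<noteq> 0 \<longleftrightarrow> extremal_adj i j) \<and>
     s (f 0) (f 1) * s (f 1) (f 2) * s (f 2) (f 3) * s (f 3) (f 0) = -1"

text \<open>The right-hand side is the square of the Pfaffian, with one term for each perfect
  matching of four points.\<close>

lemma minor_4:
  assumes "distinct [a, b, c, d]"
  shows "minor {a, b, c, d} = (s a b * s c d - s a c * s b d + s a d * s b c)\<^sup>2"
proof -
  have sg: "sign (transpose x y \<circ> q) = (if x = y then 1 else -1) * sign q" if "permutation q" for x y :: 'a and q
    using that by (simp add: sign_compose sign_swap_id permutation_swap_id)
  have ne: "a \<noteq> b" "b \<noteq> a" "a \<noteq> c" "c \<noteq> a" "a \<noteq> d" "d \<noteq> a" "b \<noteq> c" "c \<noteq> b" "b \<noteq> d" "d \<noteq> b" "c \<noteq> d" "d \<noteq> c"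
    using assms by auto
  have "minor {a, b, c, d} = (s a b)\<^sup>2 * (s c d)\<^sup>2 + (s a c)\<^sup>2 * (s b d)\<^sup>2 + (s a d)\<^sup>2 * (s b c)\<^sup>2
     - 2 * s a b * s c d * s a c * s b d + 2 * s a b * s c d * s a d * s b c - 2 * s a c * s b d * s a d * s b c"
    using ne
    apply (simp add: minor_def sum_permutes_insert)
    apply (simp add: sg sign_swap_id permutation_compose permutation_swap_id)
    apply (simp add: skew[of b a] skew[of c a] skew[of d a] skew[of c b] skew[of d b] skew[of d c])
    apply (simp add: algebra_simps power2_eq_square)
    done
  thus ?thesis by (simp add: algebra_simps power2_eq_square)
qed

text \<open>Only two perfect matchings remain. They reinforce each other if the sign product around
  the cycle is \<open>-1\<close> and cancel if it is \<open>1\<close>; this is how the orientation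
  enters.\<close>

lemma minor_4_cycle:
  assumes "distinct [a, b, c, d]" "s a c = 0" "s b d = 0"
    "s a b \<noteq> 0" "s b c \<noteq> 0" "s c d \<noteq> 0" "s d a \<noteq> 0"
  shows "minor {a, b, c, d} = 2 - 2 * (s a b * s b c * s c d * s d a)"
proof -
  have "minor {a, b, c, d} = (s a b * s c d + s a d * s b c)\<^sup>2"
    using assms by (simp add: minor_4)
  also have "\<dots> = (s a b)\<^sup>2 * (s c d)\<^sup>2 + (s d a)\<^sup>2 * (s b c)\<^sup>2 - 2 * (s a b * s b c * s c d * s d a)"
    by (simp add: skew[of a d] algebra_simps power2_eq_square)
  also have "\<dots> = 2 - 2 * (s a b * s b c * s c d * s d a)"
    using assms s_square by (simp add: power2_eq_square)
  finally show ?thesis .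
qed

lemma extremal_labelling_0_card:
  assumes "extremal_labelling f X 0"
  shows "X = {f 0, f 1, f 2, f 3}" "distinct [f 0, f 1, f 2, f 3]"
proof -
  have b: "bij_betw f {..<4} X" using assms by (simp add: extremal_labelling_def)
  have "{..<4::nat} = {0, 1, 2, 3}" by auto
  hence "f ` {0, 1, 2, 3} = X" "inj_on f {0, 1, 2, 3}" using b by (auto simp: bij_betw_def)
  thus "X = {f 0, f 1, f 2, f 3}" "distinct [f 0, f 1, f 2, f 3]" by (auto simp: inj_on_def)
qed

lemma extremal_labelling_0_rotate:
  assumes "extremal_labelling f X 0"
  shows "extremal_labelling (\<lambda>i. f (Suc i mod 4)) X 0"
proof -
  have "bij_betw (\<lambda>i. Suc i mod 4) {..<4} {..<4::nat}"
    by (rule bij_betw_byWitness[of _ "\<lambda>i. (i + 3) mod 4"]) (auto simp: less_4_iff)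
  moreover have "bij_betw f {..<4} X" using assms by (simp add: extremal_labelling_def)
  ultimately have bij: "bij_betw (f \<circ> (\<lambda>i. Suc i mod 4)) {..<4} X" by (rule bij_betw_trans)
  have "extremal_adj (Suc i mod 4) (Suc j mod 4) \<longleftrightarrow> extremal_adj i j" if "i < 4" "j < 4" for i j
    using that unfolding less_4_iff by (elim disjE) (simp_all add: extremal_adj_less_4)
  moreover have "s (f (Suc i mod 4)) (f (Suc j mod 4)) \<noteq> 0 \<longleftrightarrow> extremal_adj (Suc i mod 4) (Suc j mod 4)" for i j
    using assms by (simp add: extremal_labelling_def)
  ultimately have adj: "\<forall>i<4. \<forall>j<4. s (f (Suc i mod 4)) (f (Suc j mod 4)) \<noteq> 0 \<longleftrightarrow> extremal_adj i j"
    by blast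
  have num: "Suc 0 mod 4 = (1::nat)" "Suc 1 mod 4 = (2::nat)" "Suc 2 mod 4 = (3::nat)" "Suc 3 mod 4 = (0::nat)"
    by simp_all
  have "s (f 1) (f 2) * s (f 2) (f 3) * s (f 3) (f 0) * s (f 0) (f 1) = -1"
    using assms by (simp add: extremal_labelling_def ac_simps)
  thus ?thesis
    using bij adj unfolding extremal_labelling_def num o_def add_0 by blast
qed

text \<open>A fifth vertex may be attached anywhere on the 4-cycle, whereas
  \<open>extremal_adj\<close> attaches it at \<open>0\<close>; rotating the labelling brings the
  attaching vertex there.\<close>

lemma extremal_labelling_0_start:
  assumes "extremal_labelling f X 0" "v \<in> X"
  obtains g where "extremal_labelling g X 0" "g 0 = v"
proof -
  note r1 = extremal_labelling_0_rotate[OF assms(1)]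
  note r2 = extremal_labelling_0_rotate[OF r1]
  note r3 = extremal_labelling_0_rotate[OF r2]
  consider "v = f 0" | "v = f 1" | "v = f 2" | "v = f 3"
    using extremal_labelling_0_card(1)[OF assms(1)] assms(2) by blast
  thus ?thesis
  proof cases
    case 1
    show ?thesis by (rule that[OF assms(1)]) (simp add: 1)
  next
    case 2
    show ?thesis by (rule that[OF r1]) (simp add: 2)
  next
    case 3
    show ?thesis by (rule that[OF r2]) (simp only: 3, rule arg_cong[of _ _ f], simp)
  next
    case 4
    show ?thesis by (rule that[OF r3]) (simp only: 4, rule arg_cong[of _ _ f], simp)
  qed
qed

lemma extremal_labelling_extend:
  assumes "extremal_labelling f (X - {u}) m" "u \<in> X" "nbrs X u = {f (if m = 0 then 0 else m + 3)}"
  shows "extremal_labelling (f(m + 4 := u)) X (Suc m)"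
proof -
  let ?g = "f(m + 4 := u)"
  have f: "bij_betw f {..<m + 4} (X - {u})" "\<And>i j. i < m + 4 \<Longrightarrow> j < m + 4 \<Longrightarrow> s (f i) (f j) \<noteq> 0 \<longleftrightarrow> extremal_adj i j"
    "s (f 0) (f 1) * s (f 1) (f 2) * s (f 2) (f 3) * s (f 3) (f 0) = -1"
    using assms(1) by (auto simp: extremal_labelling_def)
  have "bij_betw ?g {..<m + 4} (X - {u})" using f(1) by (subst bij_betw_cong[of _ _ f]) auto
  hence "bij_betw ?g (insert (m + 4) {..<m + 4}) (insert u (X - {u}))"
    using notIn_Un_bij_betw[of "m + 4" "{..<m + 4}" ?g "X - {u}"] by simp
  moreover have "insert (m + 4) {..<m + 4} = {..<Suc m + 4}" by auto
  moreover have "insert u (X - {u}) = X" using assms by auto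
  ultimately have bij: "bij_betw ?g {..<Suc m + 4} X" by simp
  have new: "s u (f i) \<noteq> 0 \<longleftrightarrow> i = (if m = 0 then 0 else m + 3)" if "i < m + 4" for i
  proof -
    have "f i \<in> X" using f(1) that by (auto simp: bij_betw_def)
    hence "s u (f i) \<noteq> 0 \<longleftrightarrow> f i \<in> nbrs X u" by (simp add: nbrs_def)
    also have "\<dots> \<longleftrightarrow> f i = f (if m = 0 then 0 else m + 3)" using assms(3) by simp
    also have "\<dots> \<longleftrightarrow> i = (if m = 0 then 0 else m + 3)"
      using f(1) that by (auto simp: bij_betw_def inj_on_def)
    finally show ?thesis .
  qed
  have new': "s (f i) u \<noteq> 0 \<longleftrightarrow> i = (if m = 0 then 0 else m + 3)" if "i < m + 4" for i
    using new[OF that] s_sym_nz[of u "f i"] by simp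
  have "s (?g i) (?g j) \<noteq> 0 \<longleftrightarrow> extremal_adj i j" if ij: "i < Suc m + 4" "j < Suc m + 4" for i j
  proof -
    consider "i < m + 4" "j < m + 4" | "i = m + 4" "j < m + 4" | "i < m + 4" "j = m + 4" | "i = m + 4" "j = m + 4"
      using ij by linarith
    thus ?thesis
    proof cases
      case 1
      thus ?thesis using f(2) by simp
    next
      case 2
      thus ?thesis using new[of j] extremal_adj_new(1)[of j m] by simp
    next
      case 3
      thus ?thesis using new'[of i] extremal_adj_new(2)[of i m] by simp
    next
      case 4
      thus ?thesis using not_extremal_adj_self[of i] by simp
    qed
  qed
  thus ?thesis using bij f(3) unfolding extremal_labelling_def by simp
qed

text \<open>A degree below two would limit the coefficient to \<open>2\<close>, so \<open>X\<close>
  is a 4-cycle. Its minor is \<open>2 - 2 * e\<close> for the sign product \<open>e\<close>, and of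
  \<open>1\<close> and \<open>-1\<close> only \<open>-1\<close> gives \<open>4\<close>.\<close>

lemma extremal_labelling_base:
  assumes "finite X" "near_forest X" "card X = 4" "\<bar>minor_sum X 2\<bar> = 4"
  shows "\<exists>f. extremal_labelling f X 0"
proof -
  have reg: "deg X u = 2" if "u \<in> X" for u
    using assms(1,2)
  proof (cases rule: near_forest_cases)
    case (isolated v)
    thus ?thesis using minor_sum_4_leaf_le[OF assms(1-3), of v] assms(4) by simp
  next
    case (leaf v w)
    thus ?thesis using minor_sum_4_leaf_le[OF assms(1-3), of v] assms(4) by simp
  qed (use that in simp)
  obtain a where a: "a \<in> X" using assms(3) by fastforce
  obtain b d where bd: "nbrs X a = {b, d}" "b \<noteq> d" using reg[OF a] by (auto simp: card_2_iff)
  have abd: "b \<in> X" "d \<in> X" "a \<noteq> b" "a \<noteq> d" "s a b \<noteq> 0" "s a d \<noteq> 0"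
    using bd by (auto simp: nbrs_def set_eq_iff)
  have "card (X - {a, b, d}) = 1" using a abd bd assms by (simp add: card_Diff_subset)
  then obtain c where "X - {a, b, d} = {c}" by (auto simp: card_1_singleton_iff)
  hence X: "X = {a, b, c, d}" and dist: "distinct [a, b, c, d]"
    using a abd bd by auto
  have bX: "b \<in> X" and cX: "c \<in> X" and dX: "d \<in> X" using X by blast+
  have "c \<notin> nbrs X a" using bd(1) dist by auto
  hence ac: "s a c = 0" using cX by (simp add: nbrs_def)
  hence ca: "s c a = 0" using skew[of c a] by simp
  have "nbrs X c \<subseteq> {b, d}" using ca unfolding nbrs_def X by auto
  hence "nbrs X c = {b, d}" using reg[OF cX] bd(2) by (intro card_subset_eq) auto
  hence "b \<in> nbrs X c" "d \<in> nbrs X c" by simp_all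
  hence cbd: "s c b \<noteq> 0" "s c d \<noteq> 0" by (simp_all add: nbrs_def)
  have "s b a \<noteq> 0" "s b c \<noteq> 0" using abd(5) cbd(1) s_sym_nz[of a b] s_sym_nz[of c b] by simp_all
  hence "{a, c} \<subseteq> nbrs X b" using a cX by (simp add: nbrs_def)
  hence "{a, c} = nbrs X b"
    using reg[OF bX] dist finite_nbrs[OF assms(1)] by (intro card_subset_eq) auto
  hence "d \<notin> nbrs X b" using dist by auto
  hence bd0: "s b d = 0" using dX by (simp add: nbrs_def)
  have nz: "s a b \<noteq> 0" "s b c \<noteq> 0" "s c d \<noteq> 0" "s d a \<noteq> 0"
    using abd cbd s_sym_nz[of c b] s_sym_nz[of a d] by simp_all
  have "minor_sum X 2 = 2 - 2 * (s a b * s b c * s c d * s d a)"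
    using minor_4_cycle[OF dist ac bd0 nz] minor_sum_full[of X 2] assms unfolding X by simp
  moreover have "\<bar>s a b * s b c * s c d * s d a\<bar> = 1"
    using nz s_cases[of a b] s_cases[of b c] s_cases[of c d] s_cases[of d a] by (auto simp: abs_mult)
  ultimately have sgn: "s a b * s b c * s c d * s d a = -1" using assms(4) by linarith
  let ?f = "\<lambda>i. [a, b, c, d] ! i"
  have i4: "{..<4::nat} = {0, 1, 2, 3}" by auto
  have "bij_betw ?f {..<4} X"
    unfolding X i4 bij_betw_def inj_on_def using dist by auto
  moreover have "s (?f i) (?f j) \<noteq> 0 \<longleftrightarrow> extremal_adj i j" if "i < 4" "j < 4" for i j
    using that nz ac bd0 skew[of b a] skew[of c b] skew[of d c] skew[of a d] ca skew[of d b]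
    unfolding less_4_iff by (elim disjE) (simp_all add: extremal_adj_less_4)
  ultimately have "extremal_labelling ?f X 0" using sgn by (simp add: extremal_labelling_def)
  thus ?thesis by blast
qed

lemma extremal_labelling_exists:
  assumes "finite X" "near_forest X" "card X = m + 4" "\<bar>minor_sum X 2\<bar> = extremal_count m 2"
  shows "\<exists>f. extremal_labelling f X m"
  using assms
proof (induction m arbitrary: X)
  case 0
  thus ?case by (intro extremal_labelling_base) (auto simp: numeral_2_eq_2)
next
  case (Suc m)
  note fin = Suc.prems(1) and nf = Suc.prems(2)
  \<comment> \<open>Strict growth in \<open>m\<close> excludes an isolated vertex in the case of
    equality.\<close>
  have mono: "extremal_count m 2 < extremal_count (Suc m) 2"
  proof (cases m)
    case (Suc k)
    thus ?thesis by (simp add: numeral_2_eq_2 extremal_count_1)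
  qed (simp add: numeral_2_eq_2)
  show ?case
    using fin nf
  proof (cases rule: near_forest_cases)
    case (isolated u)
    have "\<bar>minor_sum (X - {u}) 2\<bar> \<le> extremal_count m 2"
      using fin nf isolated Suc.prems(3)
      by (intro near_forest_minor_sum_le) (auto intro: near_forest_subset)
    thus ?thesis using minor_sum_isolated[OF fin isolated, of 2] Suc.prems(4) mono by simp
  next
    case regular
    have "\<bar>minor_sum X 2\<bar> \<le> cycle_count (Suc m + 2) 2"
      using Suc.prems by (intro regular_minor_sum_le[OF fin nf regular]) auto
    thus ?thesis using cycle_count_2_less[of "Suc m"] Suc.prems(4) by simp
  next
    case (leaf u v)
    note * = near_forest_minor_sum_leaf[OF fin nf leaf, of "m + 3"]
    have v: "v \<in> X - {u}" using * Suc.prems by simp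
    have rec: "minor_sum X 2 = minor_sum (X - {u}) 2 + minor_sum (X - {u, v}) 1"
      using minor_sum_leaf[OF fin leaf, of 1] by (simp add: numeral_2_eq_2)
    show ?thesis
    proof (cases m)
      case 0
      have "\<bar>minor_sum X 2\<bar> = 6" using Suc.prems(4) 0 by (simp add: numeral_2_eq_2)
      hence "\<bar>minor_sum (X - {u}) 2\<bar> = extremal_count m 2"
        using minor_sum_5_leaf(2)[OF fin nf _ leaf] Suc.prems(3) 0 by (simp add: numeral_2_eq_2)
      then obtain f where "extremal_labelling f (X - {u}) 0"
        using Suc.IH[of "X - {u}"] * fin Suc.prems 0 by auto
      then obtain g where "extremal_labelling g (X - {u}) 0" "g 0 = v"
        using v by (rule extremal_labelling_0_start)
      thus ?thesis using extremal_labelling_extend[of g X u 0] leaf 0 by auto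
    next
      case m: (Suc k)
      have "\<bar>minor_sum (X - {u}) 2\<bar> \<le> extremal_count m 2"
        using * fin Suc.prems by (intro near_forest_minor_sum_le) auto
      moreover have "\<bar>minor_sum (X - {u, v}) 1\<bar> \<le> extremal_count k 1"
        using * fin Suc.prems m by (intro near_forest_minor_sum_le) auto
      moreover have "extremal_count (Suc m) 2 = extremal_count m 2 + extremal_count k 1"
        using m by (simp add: numeral_2_eq_2)
      ultimately have eq: "\<bar>minor_sum (X - {u}) 2\<bar> = extremal_count m 2"
        "\<bar>minor_sum (X - {u, v}) 1\<bar> = extremal_count k 1"
        using rec Suc.prems(4) by linarith+
      obtain f where f: "extremal_labelling f (X - {u}) m"
        using Suc.IH[of "X - {u}"] * fin Suc.prems eq by auto
      \<comment> \<open>\<open>X - {u, v}\<close> has as many edges as vertices, so the trade-off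
        leaves \<open>v\<close> at most one neighbour in \<open>X - {u}\<close>: it is the end of
        the path.\<close>
      have "minor_sum (X - {u, v}) 1 = int k + 4"
        using eq(2) minor_sum_1_nonneg[of "X - {u, v}"] by (simp add: extremal_count_1)
      hence d: "deg (X - {u}) v \<le> 1" using * Suc.prems m by simp
      have bij: "bij_betw f {..<m + 4} (X - {u})" using f by (simp add: extremal_labelling_def)
      hence "v \<in> f ` {..<m + 4}" using v by (simp add: bij_betw_def)
      then obtain i where i: "i < m + 4" "f i = v" by blast
      have "i = m + 3"
      proof (rule ccontr)
        assume "i \<noteq> m + 3"
        then obtain a b where ab: "a < m + 4" "b < m + 4" "a \<noteq> b" "extremal_adj i a" "extremal_adj i b"
          using extremal_adj_two[of i m] i m by auto
        have "{f a, f b} \<subseteq> nbrs (X - {u}) v"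
          using ab i f bij by (auto simp: nbrs_def extremal_labelling_def bij_betw_def)
        moreover have "f a \<noteq> f b" using ab bij by (auto simp: bij_betw_def inj_on_def)
        ultimately have "2 \<le> deg (X - {u}) v"
          using card_mono[of "nbrs (X - {u}) v" "{f a, f b}"] fin by (simp add: finite_nbrs)
        thus False using d by simp
      qed
      thus ?thesis using extremal_labelling_extend[OF f leaf(1)] leaf i m by auto
    qed
  qed
qed

lemma extremal_labelling_restrict:
  assumes "extremal_labelling f X (Suc m)"
  shows "extremal_labelling f (X - {f (m + 4)}) m" "f (m + 4) \<in> X"
    "nbrs X (f (m + 4)) = {f (if m = 0 then 0 else m + 3)}"
proof -
  have f: "bij_betw f {..<Suc m + 4} X"
    "\<And>i j. i < Suc m + 4 \<Longrightarrow> j < Suc m + 4 \<Longrightarrow> s (f i) (f j) \<noteq> 0 \<longleftrightarrow> extremal_adj i j"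
    "s (f 0) (f 1) * s (f 1) (f 2) * s (f 2) (f 3) * s (f 3) (f 0) = -1"
    using assms by (auto simp: extremal_labelling_def)
  show u: "f (m + 4) \<in> X" using f(1) by (auto simp: bij_betw_def)
  have "{..<Suc m + 4} - {m + 4} = {..<m + 4}" by auto
  hence bij: "bij_betw f {..<m + 4} (X - {f (m + 4)})"
    using u bij_betw_DiffI[OF f(1), of "{m + 4}" "{f (m + 4)}"] by (simp add: bij_betw_def)
  thus "extremal_labelling f (X - {f (m + 4)}) m"
    using f(2,3) by (simp add: extremal_labelling_def)
  have X: "X = f ` {..<Suc m + 4}" using f(1) by (simp add: bij_betw_def)
  let ?k = "if m = 0 then 0 else m + 3"
  have "nbrs X (f (m + 4)) = f ` {j. j < Suc m + 4 \<and> extremal_adj (m + 4) j}"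
    unfolding nbrs_def X using f(2)[of "m + 4"] by auto
  also have "{j. j < Suc m + 4 \<and> extremal_adj (m + 4) j} = {?k}"
  proof (rule Set.set_eqI)
    fix j
    show "j \<in> {j. j < Suc m + 4 \<and> extremal_adj (m + 4) j} \<longleftrightarrow> j \<in> {?k}"
      using extremal_adj_new(1)[of j m] not_extremal_adj_self[of "m + 4"]
      by (cases "j = m + 4") auto
  qed
  finally show "nbrs X (f (m + 4)) = {f ?k}" by simp
qed

lemma deg_eq_sum: "finite X \<Longrightarrow> int (deg X v) = (\<Sum>w\<in>X. if s v w = 0 then 0 else 1)"
  by (simp add: nbrs_def sum.If_cases Collect_conj_eq Int_commute Compl_eq)

lemma minor_sum_1_insert:
  assumes "finite Y" "v \<notin> Y"
  shows "minor_sum (insert v Y) (Suc 0) = minor_sum Y (Suc 0) + (\<Sum>w\<in>Y. if s v w = 0 then 0 else 1)"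
  using minor_sum_1[of "insert v Y" v] deg_eq_sum[of "insert v Y" v] assms by simp

lemma extremal_labelling_minor_sum:
  assumes "extremal_labelling f X m"
  shows "minor_sum X j = extremal_count m j"
  using assms
proof (induction m arbitrary: X j rule: less_induct)
  case (less m)
  have bij: "bij_betw f {..<m + 4} X" using less.prems by (simp add: extremal_labelling_def)
  hence fin: "finite X" using bij_betw_finite by auto
  have adj: "s (f i) (f j) = 0 \<longleftrightarrow> \<not> extremal_adj i j" if "i < 4" "j < 4" for i j
    using less.prems that unfolding extremal_labelling_def by (meson trans_less_add2)
  have adjs: "s (f 0) (f 1) \<noteq> 0" "s (f 1) (f 2) \<noteq> 0" "s (f 2) (f 3) \<noteq> 0" "s (f 3) (f 0) \<noteq> 0"
    "s (f 0) (f 2) = 0" "s (f 1) (f 3) = 0" "s (f 0) (f 3) \<noteq> 0"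
    using adj[of 0 1] adj[of 1 2] adj[of 2 3] adj[of 3 0] adj[of 0 2] adj[of 1 3] adj[of 0 3]
    by (auto simp: extremal_adj_less_4)
  have m0: "minor_sum {} (Suc 0) = 0" by (rule minor_sum_big) auto
  have j_cases: "j = 0 \<or> j = Suc 0 \<or> j = Suc (Suc 0) \<or> (\<exists>k. j = Suc (Suc (Suc k)))"
    by (metis not0_implies_Suc)
  consider "m = 0" | "m = 1" | k where "m = Suc (Suc k)" by (cases m; cases "m - 1") auto
  thus ?case
  proof cases
    case 1
    have X: "X = {f 0, f 1, f 2, f 3}" and dist: "distinct [f 0, f 1, f 2, f 3]"
      using extremal_labelling_0_card less.prems 1 by auto
    have "minor X = 4"
      unfolding X using minor_4_cycle[OF dist adjs(5,6,1-4)] less.prems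
      by (simp add: extremal_labelling_def)
    moreover have "card X = 4" unfolding X using dist by simp
    moreover have "minor_sum X (Suc 0) = 4"
      unfolding X using dist adjs m0 by (simp add: minor_sum_1_insert)
    ultimately show ?thesis
      using j_cases 1 fin minor_sum_0[OF fin] minor_sum_full[OF fin, of 2] minor_sum_big[OF fin, of j]
      by (auto simp: numeral_2_eq_2)
  next
    case 2
    have L: "extremal_labelling f X (Suc 0)" using less.prems 2 by simp
    note R = extremal_labelling_restrict[OF L, simplified]
    have X4: "X - {f 4} = {f 0, f 1, f 2, f 3}" and dist: "distinct [f 0, f 1, f 2, f 3]"
      using extremal_labelling_0_card[OF R(1)] by auto
    have IH: "minor_sum (X - {f 4}) j = extremal_count 0 j" for j
      using less.IH[of 0] R(1) 2 by simp
    \<comment> \<open>Here the path through the cycle vertices \<open>1\<close>, \<open>2\<close>,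
      \<open>3\<close> remains, with two edges: hence the values \<open>5 = 4 + 1\<close> and
      \<open>6 = 4 + 2\<close> in \<open>extremal_count\<close>.\<close>
    let ?Y = "X - {f 4, f 0}"
    have "?Y = X - {f 4} - {f 0}" by blast
    also have "\<dots> = {f 1, f 2, f 3}" unfolding X4 using dist by auto
    finally have Y: "?Y = {f 1, f 2, f 3}" .
    have c: "card ?Y = 3" unfolding Y using dist by simp
    have "minor_sum ?Y (Suc 0) = 2"
      unfolding Y using dist adjs m0 by (simp add: minor_sum_1_insert)
    hence e: "minor_sum ?Y i = (if i = 0 then 1 else if i = Suc 0 then 2 else 0)" for i
      using minor_sum_0[of ?Y] minor_sum_big[of ?Y i] c fin by simp
    have "minor_sum X (Suc i) = extremal_count (Suc 0) (Suc i)" for i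
      using minor_sum_leaf[OF fin R(2,3), of i] IH[of "Suc i"] e[of i] by simp
    thus ?thesis using 2 minor_sum_0[OF fin] by (cases j) simp_all
  next
    case (3 k)
    have L: "extremal_labelling f X (Suc (Suc k))" using less.prems 3 by simp
    note R = extremal_labelling_restrict[OF L]
    note R' = extremal_labelling_restrict[OF R(1)]
    have e: "X - {f (Suc k + 4)} - {f (k + 4)} = X - {f (Suc k + 4), f (k + 4)}" by auto
    have nb: "nbrs X (f (Suc k + 4)) = {f (k + 4)}" using R(3) by (simp add: add.commute)
    show ?thesis
    proof (cases j)
      case 0
      thus ?thesis using minor_sum_0[OF fin] by simp
    next
      case (Suc i)
      have "minor_sum (X - {f (Suc k + 4)}) j = extremal_count (Suc k) j"
        using less.IH[of "Suc k"] R(1) 3 by simp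
      moreover have "minor_sum (X - {f (Suc k + 4), f (k + 4)}) i = extremal_count k i"
        using less.IH[of k] R'(1) 3 e by simp
      ultimately show ?thesis using minor_sum_leaf[OF fin R(2) nb, of i] Suc 3 by simp
    qed
  qed
qed

end

section \<open>Monotonicity of the energy\<close>

text \<open>
  Coulson's integral formula is based on the fact that \<open>ln (1 + a\<^sup>2 / t\<^sup>2)\<close> has the integral
  \<open>\<pi> a\<close> over the positive reals. Working with an antiderivative avoids integration.
\<close>

definition energy_profile :: "real \<Rightarrow> real \<Rightarrow> real" where
  "energy_profile a t = t * ln (1 + a\<^sup>2 / t\<^sup>2) + 2 * a * arctan (t / a)"

lemma energy_profile_deriv:
  assumes "a \<ge> 0" "t > 0"
  shows "(energy_profile a has_real_derivative ln (1 + a\<^sup>2 / t\<^sup>2)) (at t)"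
proof (cases "a = 0")
  case True
  thus ?thesis by (simp add: energy_profile_def[abs_def])
next
  case False
  hence a: "a > 0" using assms by simp
  have pos: "1 + a\<^sup>2 / t\<^sup>2 > 0" by (simp add: add_pos_nonneg)
  have d1: "((\<lambda>t. 1 + a\<^sup>2 / t\<^sup>2) has_real_derivative - (a\<^sup>2 * (2 * t)) / (t\<^sup>2 * t\<^sup>2)) (at t)"
    using assms by (auto intro!: derivative_eq_intros)
  have "((\<lambda>t. t * ln (1 + a\<^sup>2 / t\<^sup>2) + 2 * a * arctan (t / a)) has_real_derivative
     1 * ln (1 + a\<^sup>2 / t\<^sup>2) + (1 / (1 + a\<^sup>2 / t\<^sup>2) * (- (a\<^sup>2 * (2 * t)) / (t\<^sup>2 * t\<^sup>2))) * t +
     2 * a * (inverse (1 + (t / a)\<^sup>2) * (1 / a))) (at t)"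
    by (intro DERIV_add DERIV_mult DERIV_cmult DERIV_ident DERIV_chain2[OF DERIV_ln_divide[OF pos] d1]
        DERIV_chain2[OF DERIV_arctan] DERIV_cdivide)
  \<comment> \<open>The rational terms coming from the logarithm and from the arctangent
    cancel.\<close>
  moreover have "(1 / (1 + a\<^sup>2 / t\<^sup>2) * (- (a\<^sup>2 * (2 * t)) / (t\<^sup>2 * t\<^sup>2))) * t = - (2 * a\<^sup>2 / (t\<^sup>2 + a\<^sup>2))"
  proof -
    have gen: "1 / A * (- (b * (2 * t)) / C) * t = - (t\<^sup>2 * (2 * b)) / (A * C)" for A b C :: real
      by (simp add: power2_eq_square)
    have "(1 + a\<^sup>2 / t\<^sup>2) * (t\<^sup>2 * t\<^sup>2) = t\<^sup>2 * (t\<^sup>2 + a\<^sup>2)"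
      using assms by (simp add: field_simps)
    hence "(1 / (1 + a\<^sup>2 / t\<^sup>2) * (- (a\<^sup>2 * (2 * t)) / (t\<^sup>2 * t\<^sup>2))) * t = - (t\<^sup>2 * (2 * a\<^sup>2)) / (t\<^sup>2 * (t\<^sup>2 + a\<^sup>2))"
      unfolding gen by (simp only:)
    also have "\<dots> = - ((t\<^sup>2 * (2 * a\<^sup>2)) / (t\<^sup>2 * (t\<^sup>2 + a\<^sup>2)))" by simp
    also have "(t\<^sup>2 * (2 * a\<^sup>2)) / (t\<^sup>2 * (t\<^sup>2 + a\<^sup>2)) = 2 * a\<^sup>2 / (t\<^sup>2 + a\<^sup>2)"
      using assms by (intro mult_divide_mult_cancel_left) simp
    finally show ?thesis .
  qed
  moreover have "2 * a * (inverse (1 + (t / a)\<^sup>2) * (1 / a)) = 2 * a\<^sup>2 / (t\<^sup>2 + a\<^sup>2)"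
    using a by (simp add: field_simps power2_eq_square)
  ultimately show ?thesis by (simp add: energy_profile_def[abs_def])
qed

lemma energy_profile_at_0: "a \<ge> 0 \<Longrightarrow> (energy_profile a \<longlongrightarrow> 0) (at_right 0)"
proof (cases "a = 0")
  case False
  assume "a \<ge> 0"
  hence "a > 0" using False by simp
  thus ?thesis unfolding energy_profile_def[abs_def] by real_asymp
qed (simp add: energy_profile_def[abs_def])

text \<open>The logarithmic term tends to zero and the arctangent contributes
  \<open>2 * a * (pi / 2)\<close>.\<close>

lemma energy_profile_at_top: "a \<ge> 0 \<Longrightarrow> (energy_profile a \<longlongrightarrow> pi * a) at_top"
proof (cases "a = 0")
  case False
  assume "a \<ge> 0"
  hence "a > 0" using False by simp
  thus ?thesis unfolding energy_profile_def[abs_def] by real_asymp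
qed (simp add: energy_profile_def[abs_def])

definition total_profile :: "real multiset \<Rightarrow> real \<Rightarrow> real" where
  "total_profile M t = (\<Sum>a\<in>#M. energy_profile a t)"

lemma total_profile_deriv:
  assumes "\<And>a. a \<in># M \<Longrightarrow> a \<ge> 0" "t > 0"
  shows "(total_profile M has_real_derivative (\<Sum>a\<in>#M. ln (1 + a\<^sup>2 / t\<^sup>2))) (at t)"
  using assms(1)
proof (induction M)
  case (add a M)
  have "((\<lambda>t. energy_profile a t + total_profile M t) has_real_derivative
     ln (1 + a\<^sup>2 / t\<^sup>2) + (\<Sum>a\<in>#M. ln (1 + a\<^sup>2 / t\<^sup>2))) (at t)"
    by (rule DERIV_add) (use add energy_profile_deriv[of a t] assms(2) in auto)
  thus ?case by (simp add: total_profile_def[abs_def])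
qed (simp add: total_profile_def[abs_def])

lemma total_profile_at_0:
  assumes "\<And>a. a \<in># M \<Longrightarrow> a \<ge> 0"
  shows "(total_profile M \<longlongrightarrow> 0) (at_right 0)"
  using assms
proof (induction M)
  case (add a M)
  have "((\<lambda>t. energy_profile a t + total_profile M t) \<longlongrightarrow> 0 + 0) (at_right 0)"
    by (rule tendsto_add) (use add energy_profile_at_0[of a] in auto)
  thus ?case by (simp add: total_profile_def[abs_def])
qed (simp add: total_profile_def[abs_def])

lemma total_profile_at_top:
  assumes "\<And>a. a \<in># M \<Longrightarrow> a \<ge> 0"
  shows "(total_profile M \<longlongrightarrow> pi * (\<Sum>a\<in>#M. a)) at_top"
  using assms
proof (induction M)
  case (add a M)
  have "((\<lambda>t. energy_profile a t + total_profile M t) \<longlongrightarrow> pi * a + pi * (\<Sum>a\<in>#M. a)) at_top"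
    by (rule tendsto_add) (use add energy_profile_at_top[of a] in auto)
  thus ?case by (simp add: total_profile_def[abs_def] algebra_simps)
qed (simp add: total_profile_def[abs_def])

text \<open>The subtracted term depends on \<open>size M\<close> alone and cancels when multisets of
  equal size are compared.\<close>

lemma sum_mset_ln:
  fixes t :: real
  assumes "t > 0"
  shows "(\<Sum>a\<in>#M. ln (1 + a\<^sup>2 / t\<^sup>2)) = ln (\<Prod>a\<in>#M. t\<^sup>2 + a\<^sup>2) - size M * ln (t\<^sup>2)"
proof (induction M)
  case (add a M)
  have pos: "t\<^sup>2 + a\<^sup>2 > 0" "(\<Prod>a\<in>#M. t\<^sup>2 + a\<^sup>2) > 0" for a
  proof -
    show *: "t\<^sup>2 + a\<^sup>2 > 0" for a using assms by (simp add: add_pos_nonneg)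
    show "(\<Prod>a\<in>#M. t\<^sup>2 + a\<^sup>2) > 0" by (induction M) (use * in auto)
  qed
  have "1 + a\<^sup>2 / t\<^sup>2 = (t\<^sup>2 + a\<^sup>2) / t\<^sup>2" using assms by (simp add: field_simps)
  hence "ln (1 + a\<^sup>2 / t\<^sup>2) = ln (t\<^sup>2 + a\<^sup>2) - ln (t\<^sup>2)"
    using pos assms by (simp add: ln_div)
  moreover have "ln ((t\<^sup>2 + a\<^sup>2) * (\<Prod>a\<in>#M. t\<^sup>2 + a\<^sup>2)) = ln (t\<^sup>2 + a\<^sup>2) + ln (\<Prod>a\<in>#M. t\<^sup>2 + a\<^sup>2)"
    using pos by (intro ln_mult_pos) auto
  moreover have "real (size (add_mset a M)) * ln (t\<^sup>2) = ln (t\<^sup>2) + real (size M) * ln (t\<^sup>2)"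
    by (simp add: distrib_right)
  ultimately show ?case using add by simp
qed simp

lemma prod_mset_pos:
  fixes f :: "'a \<Rightarrow> real"
  shows "(\<And>a. a \<in># M \<Longrightarrow> f a > 0) \<Longrightarrow> (\<Prod>a\<in>#M. f a) > 0"
  by (induction M) auto

text \<open>The difference \<open>F\<close> of the total profiles tends to \<open>0\<close> at
  \<open>0\<close> and to \<open>pi\<close> times the difference of the sums at infinity. Its
  derivative is the difference of the logarithms of the two products, so \<open>F\<close> is
  nondecreasing.\<close>

lemma sum_mset_mono_of_prod:
  fixes M N :: "real multiset"
  assumes nonneg: "\<And>a. a \<in># M \<Longrightarrow> a \<ge> 0" "\<And>a. a \<in># N \<Longrightarrow> a \<ge> 0"
    and size: "size M = size N"
    and le: "\<And>t. t > 0 \<Longrightarrow> (\<Prod>a\<in>#M. t\<^sup>2 + a\<^sup>2) \<le> (\<Prod>a\<in>#N. t\<^sup>2 + a\<^sup>2)"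
  shows "(\<Sum>a\<in>#M. a) \<le> (\<Sum>a\<in>#N. a)"
    and "(\<And>t. t > 0 \<Longrightarrow> (\<Prod>a\<in>#M. t\<^sup>2 + a\<^sup>2) < (\<Prod>a\<in>#N. t\<^sup>2 + a\<^sup>2)) \<Longrightarrow>
      (\<Sum>a\<in>#M. a) < (\<Sum>a\<in>#N. a)"
proof -
  define F where "F t = total_profile N t - total_profile M t" for t
  define F' where "F' t = (\<Sum>a\<in>#N. ln (1 + a\<^sup>2 / t\<^sup>2)) - (\<Sum>a\<in>#M. ln (1 + a\<^sup>2 / t\<^sup>2))" for t :: real
  have F'_eq: "F' t = ln (\<Prod>a\<in>#N. t\<^sup>2 + a\<^sup>2) - ln (\<Prod>a\<in>#M. t\<^sup>2 + a\<^sup>2)" if "t > 0" for t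
    using sum_mset_ln[OF that] size by (simp add: F'_def)
  have pos: "(\<Prod>a\<in>#M. t\<^sup>2 + a\<^sup>2) > 0" if "t > 0" for t :: real and M
    using that by (intro prod_mset_pos) (simp add: add_pos_nonneg)
  have deriv: "(F has_real_derivative F' t) (at t)" if "t > 0" for t
    unfolding F_def[abs_def] F'_def using nonneg that by (intro DERIV_diff total_profile_deriv) auto
  have F'_nonneg: "F' t \<ge> 0" if "t > 0" for t
    using le[OF that] pos[OF that] by (simp add: F'_eq[OF that])
  have mono: "F x \<le> F y" if "0 < x" "x \<le> y" for x y
  proof (rule DERIV_nonneg_imp_nondecreasing[OF that(2)])
    fix z assume "x \<le> z"
    thus "\<exists>d. (F has_real_derivative d) (at z) \<and> 0 \<le> d"
      using that deriv[of z] F'_nonneg[of z] by (intro exI[of _ "F' z"]) auto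
  qed
  have lim0: "(F \<longlongrightarrow> 0) (at_right 0)"
    using tendsto_diff[OF total_profile_at_0[of N] total_profile_at_0[of M]] nonneg
    by (simp add: F_def[abs_def])
  have limtop: "(F \<longlongrightarrow> pi * (\<Sum>a\<in>#N. a) - pi * (\<Sum>a\<in>#M. a)) at_top"
    using tendsto_diff[OF total_profile_at_top[of N] total_profile_at_top[of M]] nonneg
    by (simp add: F_def[abs_def])
  have F_nonneg: "F y \<ge> 0" if "y > 0" for y
  proof (rule tendsto_upperbound[OF lim0])
    show "eventually (\<lambda>x. F x \<le> F y) (at_right 0)"
      using that mono by (auto simp: eventually_at_right_field intro!: exI[of _ y])
  qed simp
  have lower: "F y \<le> pi * (\<Sum>a\<in>#N. a) - pi * (\<Sum>a\<in>#M. a)" if "y > 0" for y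
  proof (rule tendsto_lowerbound[OF limtop])
    show "eventually (\<lambda>x. F y \<le> F x) at_top"
      using eventually_ge_at_top[of y] by eventually_elim (use that mono in auto)
  qed simp
  show "(\<Sum>a\<in>#M. a) \<le> (\<Sum>a\<in>#N. a)"
  proof -
    have "pi * (\<Sum>a\<in>#M. a) \<le> pi * (\<Sum>a\<in>#N. a)" using lower[of 1] F_nonneg[of 1] by linarith
    thus ?thesis by (simp only: mult_le_cancel_left_pos[OF pi_gt_zero])
  qed
  assume less: "\<And>t. t > 0 \<Longrightarrow> (\<Prod>a\<in>#M. t\<^sup>2 + a\<^sup>2) < (\<Prod>a\<in>#N. t\<^sup>2 + a\<^sup>2)"
  have F'_pos: "F' t > 0" if "t > 0" for t
    using less[OF that] pos[OF that] by (simp add: F'_eq[OF that])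
  \<comment> \<open>A strict increase on one interval survives both limits, since \<open>F\<close>
    is monotone on either side of it.\<close>
  have "F 1 < F 2"
  proof (rule DERIV_pos_imp_increasing[of 1 2 F])
    fix z :: real assume "1 \<le> z"
    thus "\<exists>d. (F has_real_derivative d) (at z) \<and> 0 < d"
      using deriv[of z] F'_pos[of z] by (intro exI[of _ "F' z"]) auto
  qed simp
  hence "pi * (\<Sum>a\<in>#M. a) < pi * (\<Sum>a\<in>#N. a)"
    using lower[of 2] F_nonneg[of 1] by linarith
  thus "(\<Sum>a\<in>#M. a) < (\<Sum>a\<in>#N. a)"
    by (simp only: mult_less_cancel_left_pos[OF pi_gt_zero])
qed

section \<open>Characteristic polynomials and eigenvalues of skew matrices\<close>

definition int_mat :: "nat \<Rightarrow> (nat \<Rightarrow> nat \<Rightarrow> int) \<Rightarrow> complex mat" where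
  "int_mat n s = mat n n (\<lambda>(i, j). of_int (s i j))"

definition mat_energy :: "complex mat \<Rightarrow> real" where
  "mat_energy A = (\<Sum>\<mu>\<in>#proots (char_poly A). cmod \<mu>)"

text \<open>Multiplying out, \<open>Y\<close> collects the rows in which \<open>f\<close> is chosen.
  In the other rows the factor is zero unless \<open>p\<close> fixes the row, so only permutations
  of \<open>Y\<close> remain.\<close>

lemma sum_permutes_expand:
  fixes x :: "'a::comm_ring_1"
  assumes fin: "finite A"
  shows "(\<Sum>p | p permutes A. of_int (sign p) * (\<Prod>i\<in>A. f i (p i) + (if p i = i then x else 0))) =
    (\<Sum>Y\<in>Pow A. x ^ (card A - card Y) * (\<Sum>p | p permutes Y. of_int (sign p) * (\<Prod>i\<in>Y. f i (p i))))"
proof -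
  have "(\<Sum>p | p permutes A. of_int (sign p) * (\<Prod>i\<in>A. f i (p i) + (if p i = i then x else 0))) =
    (\<Sum>p | p permutes A. \<Sum>Y\<in>Pow A. of_int (sign p) * ((\<Prod>i\<in>Y. f i (p i)) * (\<Prod>i\<in>A - Y. if p i = i then x else 0)))"
    by (simp add: prod_add[OF fin] sum_distrib_left)
  also have "\<dots> = (\<Sum>Y\<in>Pow A. \<Sum>p | p permutes A. of_int (sign p) * ((\<Prod>i\<in>Y. f i (p i)) * (\<Prod>i\<in>A - Y. if p i = i then x else 0)))"
    by (rule sum.swap)
  also have "\<dots> = (\<Sum>Y\<in>Pow A. x ^ (card A - card Y) * (\<Sum>p | p permutes Y. of_int (sign p) * (\<Prod>i\<in>Y. f i (p i))))"
  proof (rule sum.cong[OF refl])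
    fix Y assume "Y \<in> Pow A"
    hence Y: "Y \<subseteq> A" by simp
    have "(\<Sum>p | p permutes A. of_int (sign p) * ((\<Prod>i\<in>Y. f i (p i)) * (\<Prod>i\<in>A - Y. if p i = i then x else 0))) =
      (\<Sum>p | p permutes Y. of_int (sign p) * ((\<Prod>i\<in>Y. f i (p i)) * (\<Prod>i\<in>A - Y. if p i = i then x else 0)))"
    proof (rule sum.mono_neutral_right)
      show "finite {p. p permutes A}" using fin by (rule finite_permutations)
      show "{p. p permutes Y} \<subseteq> {p. p permutes A}" using Y by (auto intro: permutes_subset)
      show "\<forall>p\<in>{p. p permutes A} - {p. p permutes Y}.
        of_int (sign p) * ((\<Prod>i\<in>Y. f i (p i)) * (\<Prod>i\<in>A - Y. if p i = i then x else 0)) = 0"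
      proof
        fix p assume "p \<in> {p. p permutes A} - {p. p permutes Y}"
        hence p: "p permutes A" "\<not> p permutes Y" by auto
        then obtain i where "i \<in> A - Y" "p i \<noteq> i" using permutes_superset by blast
        hence "(\<Prod>i\<in>A - Y. if p i = i then x else 0) = 0" using fin by (intro prod_zero) auto
        thus "of_int (sign p) * ((\<Prod>i\<in>Y. f i (p i)) * (\<Prod>i\<in>A - Y. if p i = i then x else 0)) = 0"
          by simp
      qed
    qed
    also have "\<dots> = (\<Sum>p | p permutes Y. of_int (sign p) * ((\<Prod>i\<in>Y. f i (p i)) * x ^ (card A - card Y)))"
    proof (rule sum.cong[OF refl])
      fix p assume "p \<in> {p. p permutes Y}"
      hence "(\<Prod>i\<in>A - Y. if p i = i then x else 0) = (\<Prod>i\<in>A - Y. x)"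
        by (intro prod.cong) (auto simp: permutes_not_in)
      also have "\<dots> = x ^ (card A - card Y)" using Y fin by (simp add: card_Diff_subset finite_subset)
      finally show "of_int (sign p) * ((\<Prod>i\<in>Y. f i (p i)) * (\<Prod>i\<in>A - Y. if p i = i then x else 0)) =
        of_int (sign p) * ((\<Prod>i\<in>Y. f i (p i)) * x ^ (card A - card Y))" by simp
    qed
    finally show "(\<Sum>p | p permutes A. of_int (sign p) * ((\<Prod>i\<in>Y. f i (p i)) * (\<Prod>i\<in>A - Y. if p i = i then x else 0))) =
      x ^ (card A - card Y) * (\<Sum>p | p permutes Y. of_int (sign p) * (\<Prod>i\<in>Y. f i (p i)))"
      by (simp add: sum_distrib_left mult_ac)
  qed
  finally show ?thesis .
qed

lemma int_mat_carrier: "int_mat n s \<in> carrier_mat n n"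
  by (simp add: int_mat_def)

text \<open>Odd minors vanish, and on even ones the sign of \<open>- s\<close> disappears. Where the
  exponent \<open>n - 2 * j\<close> is truncated, \<open>minor_sum\<close> is zero.\<close>

lemma poly_char_poly_int_mat:
  assumes "skew_form s"
  shows "poly (char_poly (int_mat n s)) x =
    (\<Sum>j\<le>n. x ^ (n - 2 * j) * of_int (skew_form.minor_sum s {0..<n} j))"
proof -
  interpret skew_form s by fact
  let ?A = "{0..<n}"
  have "poly (char_poly (int_mat n s)) x = det (- char_matrix (int_mat n s) x)"
    by (rule char_poly_matrix[OF int_mat_carrier])
  also have "- char_matrix (int_mat n s) x = mat n n (\<lambda>(i, j). - of_int (s i j) + (if j = i then x else 0))"
    by (rule eq_matI) (auto simp: char_matrix_def int_mat_def)
  also have "det \<dots> = (\<Sum>p | p permutes ?A. of_int (sign p) *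
      (\<Prod>i\<in>?A. - of_int (s i (p i)) + (if p i = i then x else 0)))"
    by (subst det_def'[of _ n]) (auto intro!: sum.cong prod.cong simp: permutes_in_image)
  also have "\<dots> = (\<Sum>Y\<in>Pow ?A. x ^ (n - card Y) *
      (\<Sum>p | p permutes Y. of_int (sign p) * (\<Prod>i\<in>Y. - of_int (s i (p i)))))"
    using sum_permutes_expand[of ?A "\<lambda>i j. - of_int (s i j)" x] by simp
  also have "\<dots> = (\<Sum>Y\<in>Pow ?A. x ^ (n - card Y) * ((-1) ^ card Y * of_int (minor Y)))"
  proof (rule sum.cong[OF refl])
    fix Y assume "Y \<in> Pow ?A"
    have "(\<Prod>i\<in>Y. - of_int (s i (p i)) :: complex) = (-1) ^ card Y * (\<Prod>i\<in>Y. of_int (s i (p i)))" for p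
      by (rule prod_uminus)
    thus "x ^ (n - card Y) * (\<Sum>p | p permutes Y. of_int (sign p) * (\<Prod>i\<in>Y. - of_int (s i (p i)))) =
      x ^ (n - card Y) * ((-1) ^ card Y * of_int (minor Y))"
      by (simp add: minor_def sum_distrib_left mult_ac)
  qed
  also have "\<dots> = (\<Sum>Y\<in>{Y \<in> Pow ?A. even (card Y)}. x ^ (n - card Y) * of_int (minor Y))"
  proof (rule sum.mono_neutral_cong_right)
    show "\<forall>Y\<in>Pow ?A - {Y \<in> Pow ?A. even (card Y)}. x ^ (n - card Y) * ((-1) ^ card Y * of_int (minor Y)) = 0"
    proof
      fix Y assume Y: "Y \<in> Pow ?A - {Y \<in> Pow ?A. even (card Y)}"
      hence "minor Y = 0" by (intro minor_odd) (auto intro: finite_subset[of _ ?A])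
      thus "x ^ (n - card Y) * ((-1) ^ card Y * of_int (minor Y)) = 0" by simp
    qed
  qed auto
  also have "\<dots> = (\<Sum>j\<le>n. \<Sum>Y | Y \<in> {Y \<in> Pow ?A. even (card Y)} \<and> card Y div 2 = j. x ^ (n - card Y) * of_int (minor Y))"
  proof (rule sum.group[symmetric])
    show "(\<lambda>Y. card Y div 2) ` {Y \<in> Pow ?A. even (card Y)} \<subseteq> {..n}"
    proof clarsimp
      fix Y assume "Y \<subseteq> ?A"
      hence "card Y \<le> n" using card_mono[of ?A Y] by simp
      thus "card Y div 2 \<le> n" by linarith
    qed
  qed auto
  also have "\<dots> = (\<Sum>j\<le>n. x ^ (n - 2 * j) * of_int (minor_sum ?A j))"
  proof (rule sum.cong[OF refl])
    fix j
    have "{Y. Y \<in> {Y \<in> Pow ?A. even (card Y)} \<and> card Y div 2 = j} = {Y. Y \<subseteq> ?A \<and> card Y = 2 * j}"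
      by auto
    thus "(\<Sum>Y | Y \<in> {Y \<in> Pow ?A. even (card Y)} \<and> card Y div 2 = j. x ^ (n - card Y) * of_int (minor Y)) =
      x ^ (n - 2 * j) * of_int (minor_sum ?A j)"
      by (simp add: minor_sum_def sum_distrib_left)
  qed
  finally show ?thesis .
qed

text \<open>The Hermitian form \<open>q\<close> of the matrix at an eigenvector is
  \<open>\<mu>\<close> times its squared norm \<open>N\<close>, and for a real skew matrix it is the
  negative of its own conjugate.\<close>

lemma skew_eigenvalue_imaginary:
  assumes "skew_form s" "eigenvalue (int_mat n s) \<mu>"
  shows "Re \<mu> = 0"
proof -
  interpret skew_form s by fact
  obtain v where v: "v \<in> carrier_vec n" "v \<noteq> 0\<^sub>v n" "int_mat n s *\<^sub>v v = \<mu> \<cdot>\<^sub>v v"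
    using assms(2) by (auto simp: eigenvalue_def eigenvector_def int_mat_def)
  have ev: "(\<Sum>j<n. of_int (s i j) * v $ j) = \<mu> * v $ i" if "i < n" for i
  proof -
    have "(int_mat n s *\<^sub>v v) $ i = (\<mu> \<cdot>\<^sub>v v) $ i" using v by simp
    thus ?thesis using that v(1)
      by (simp add: int_mat_def mult_mat_vec_def scalar_prod_def atLeast0LessThan)
  qed
  define q where "q = (\<Sum>i<n. \<Sum>j<n. cnj (v $ i) * (of_int (s i j) * v $ j))"
  define N where "N = (\<Sum>i<n. (cmod (v $ i))\<^sup>2)"
  have "q = (\<Sum>i<n. cnj (v $ i) * (\<mu> * v $ i))"
    unfolding q_def by (intro sum.cong) (auto simp: ev simp flip: sum_distrib_left)
  also have "\<dots> = \<mu> * of_real N"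
    unfolding N_def of_real_sum sum_distrib_left
    by (intro sum.cong) (simp_all only: complex_norm_square mult_ac)
  finally have q: "q = \<mu> * of_real N" .
  have "cnj q = (\<Sum>i<n. \<Sum>j<n. v $ i * (of_int (s i j) * cnj (v $ j)))"
    by (simp add: q_def)
  also have "\<dots> = (\<Sum>j<n. \<Sum>i<n. v $ i * (of_int (s i j) * cnj (v $ j)))" by (rule sum.swap)
  also have "\<dots> = (\<Sum>j<n. \<Sum>i<n. - (cnj (v $ j) * (of_int (s j i) * v $ i)))"
  proof (intro sum.cong refl)
    fix i j
    have "of_int (s i j) = - (of_int (s j i) :: complex)" by (subst skew) simp
    thus "v $ i * (of_int (s i j) * cnj (v $ j)) = - (cnj (v $ j) * (of_int (s j i) * v $ i))"
      by (simp add: mult_ac)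
  qed
  also have "\<dots> = - q" by (simp add: q_def sum_negf)
  finally have "Re q = 0" by (simp add: complex_eq_iff)
  hence "Re \<mu> * N = 0" using q by simp
  moreover have "N \<noteq> 0"
  proof
    assume "N = 0"
    hence "v $ i = 0" if "i < n" for i
      using that by (simp add: N_def sum_nonneg_eq_0_iff)
    hence "v = 0\<^sub>v n" using v(1) by auto
    thus False using v(2) by simp
  qed
  ultimately show ?thesis by simp
qed

text \<open>For imaginary \<open>\<mu>\<close> and real \<open>t\<close>, \<open>t\<close> and
  \<open>\<mu>\<close> are orthogonal in the plane, so each factor is the squared distance from
  \<open>t\<close> to \<open>\<mu>\<close>.\<close>

lemma prod_mset_cmod:
  assumes "skew_form s"
  shows "(\<Prod>\<mu>\<in>#proots (char_poly (int_mat n s)). t\<^sup>2 + (cmod \<mu>)\<^sup>2) =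
    (cmod (poly (char_poly (int_mat n s)) (of_real t)))\<^sup>2"
    "size (proots (char_poly (int_mat n s))) = n"
proof -
  let ?p = "char_poly (int_mat n s)"
  have deg: "degree ?p = n" "lead_coeff ?p = 1"
    using degree_monic_char_poly[OF int_mat_carrier[of n s]] by auto
  thus "size (proots ?p) = n" by (simp add: size_proots_complex)
  have "?p \<noteq> 0" using deg(2) by auto
  hence im: "Re \<mu> = 0" if "\<mu> \<in># proots ?p" for \<mu>
    using that assms eigenvalue_root_char_poly[OF int_mat_carrier]
    by (intro skew_eigenvalue_imaginary[of s n]) auto
  have fac: "t\<^sup>2 + (cmod \<mu>)\<^sup>2 = (cmod (of_real t - \<mu>))\<^sup>2" if "\<mu> \<in># proots ?p" for \<mu>
    using im[OF that] by (simp add: cmod_power2)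
  have "poly ?p (of_real t) = poly (\<Prod>\<mu>\<in>#proots ?p. [:-\<mu>, 1:]) (of_real t)"
    using complex_poly_decompose_multiset[of ?p] deg(2) by simp
  also have "\<dots> = (\<Prod>\<mu>\<in>#proots ?p. of_real t - \<mu>)"
    by (simp add: poly_prod_mset multiset.map_comp o_def)
  finally have "(cmod (poly ?p (of_real t)))\<^sup>2 = (cmod (\<Prod>\<mu>\<in>#proots ?p. of_real t - \<mu>))\<^sup>2" by simp
  also have "\<dots> = (\<Prod>\<mu>\<in>#proots ?p. (cmod (of_real t - \<mu>))\<^sup>2)"
  proof -
    have "(cmod (\<Prod>\<mu>\<in>#M. of_real t - \<mu>))\<^sup>2 = (\<Prod>\<mu>\<in>#M. (cmod (of_real t - \<mu>))\<^sup>2)" for M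
      by (induction M) (simp_all add: norm_mult power_mult_distrib)
    thus ?thesis .
  qed
  also have "\<dots> = (\<Prod>\<mu>\<in>#proots ?p. t\<^sup>2 + (cmod \<mu>)\<^sup>2)"
    using fac by (intro arg_cong[of _ _ prod_mset] image_mset_cong) simp
  finally show "(\<Prod>\<mu>\<in>#proots ?p. t\<^sup>2 + (cmod \<mu>)\<^sup>2) = (cmod (poly ?p (of_real t)))\<^sup>2" by simp
qed

text \<open>The first polynomial is bounded by the triangle inequality; the second has nonnegative
  coefficients and is its own modulus at \<open>t > 0\<close>. So coefficients need comparing in
  absolute value only.\<close>

lemma mat_energy_mono:
  assumes s: "skew_form s" and s': "skew_form s'"
    and le: "\<And>j. \<bar>skew_form.minor_sum s {0..<n} j\<bar> \<le> skew_form.minor_sum s' {0..<n} j"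
  shows "mat_energy (int_mat n s) \<le> mat_energy (int_mat n s')"
    and "2 * k \<le> n \<Longrightarrow> \<bar>skew_form.minor_sum s {0..<n} k\<bar> < skew_form.minor_sum s' {0..<n} k \<Longrightarrow>
      mat_energy (int_mat n s) < mat_energy (int_mat n s')"
proof -
  let ?e = "skew_form.minor_sum s {0..<n}" and ?e' = "skew_form.minor_sum s' {0..<n}"
  let ?p = "char_poly (int_mat n s)" and ?p' = "char_poly (int_mat n s')"
  let ?M = "image_mset cmod (proots ?p)" and ?N = "image_mset cmod (proots ?p')"
  define b where "b t = (\<Sum>j\<le>n. t ^ (n - 2 * j) * of_int \<bar>?e j\<bar>)" for t :: real
  define b' where "b' t = (\<Sum>j\<le>n. t ^ (n - 2 * j) * of_int (?e' j))" for t :: real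
  have pM: "(\<Prod>a\<in>#?M. t\<^sup>2 + a\<^sup>2) = (cmod (poly ?p (of_real t)))\<^sup>2" for t
    using prod_mset_cmod(1)[OF s, of t n] by (simp add: multiset.map_comp o_def)
  have pN: "(\<Prod>a\<in>#?N. t\<^sup>2 + a\<^sup>2) = (cmod (poly ?p' (of_real t)))\<^sup>2" for t
    using prod_mset_cmod(1)[OF s', of t n] by (simp add: multiset.map_comp o_def)
  have size: "size ?M = size ?N" using prod_mset_cmod(2) s s' by simp
  have up: "cmod (poly ?p (of_real t)) \<le> b t" if "t > 0" for t
    unfolding poly_char_poly_int_mat[OF s] b_def
    by (rule order.trans[OF norm_sum]) (use that in \<open>simp add: norm_mult norm_power\<close>)
  have bb: "b t \<le> b' t" if "t > 0" for t
    unfolding b_def b'_def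
  proof (intro sum_mono mult_left_mono)
    show "real_of_int \<bar>?e j\<bar> \<le> real_of_int (?e' j)" for j using le[of j] by (simp only: of_int_le_iff)
  qed (use that in auto)
  have b0: "b t \<ge> 0" if "t > 0" for t
    unfolding b_def using that by (intro sum_nonneg) auto
  have p': "cmod (poly ?p' (of_real t)) = b' t" if "t > 0" for t
  proof -
    have "poly ?p' (of_real t) = of_real (b' t)"
      unfolding poly_char_poly_int_mat[OF s'] b'_def by simp
    thus ?thesis using bb[OF that] b0[OF that] by simp
  qed
  have prods: "(\<Prod>a\<in>#?M. t\<^sup>2 + a\<^sup>2) \<le> (\<Prod>a\<in>#?N. t\<^sup>2 + a\<^sup>2)" if "t > 0" for t
    unfolding pM pN p'[OF that] using up[OF that] bb[OF that] by (intro power_mono) auto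
  have nn: "\<And>a. a \<in># ?M \<Longrightarrow> a \<ge> 0" "\<And>a. a \<in># ?N \<Longrightarrow> a \<ge> 0" by auto
  show "mat_energy (int_mat n s) \<le> mat_energy (int_mat n s')"
    using sum_mset_mono_of_prod(1)[OF nn size prods] by (simp add: mat_energy_def)
  assume k: "2 * k \<le> n" "\<bar>?e k\<bar> < ?e' k"
  have "(\<Prod>a\<in>#?M. t\<^sup>2 + a\<^sup>2) < (\<Prod>a\<in>#?N. t\<^sup>2 + a\<^sup>2)" if "t > 0" for t
  proof -
    have "b t < b' t"
      unfolding b_def b'_def
    proof (rule sum_strict_mono_ex1)
      show "\<forall>j\<in>{..n}. t ^ (n - 2 * j) * of_int \<bar>?e j\<bar> \<le> t ^ (n - 2 * j) * of_int (?e' j)"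
        using that le by (auto intro!: mult_left_mono simp del: of_int_abs)
      show "\<exists>j\<in>{..n}. t ^ (n - 2 * j) * of_int \<bar>?e j\<bar> < t ^ (n - 2 * j) * of_int (?e' j)"
        using that k by (intro bexI[of _ k]) (auto simp del: of_int_abs)
    qed simp
    thus ?thesis unfolding pM pN p'[OF that] using up[OF that] by (intro power_strict_mono) auto
  qed
  thus "mat_energy (int_mat n s) < mat_energy (int_mat n s')"
    using sum_mset_mono_of_prod(2)[OF nn size prods] by (simp add: mat_energy_def)
qed

section \<open>Unicyclic graphs and their orientations\<close>

context skew_form
begin

text \<open>The edge counts of the vertex-deleted subgraphs add up to \<open>(n - 2) * e\<close> and
  also to \<open>n * e\<close> minus the degree sum, where \<open>n = card X\<close> and
  \<open>e = minor_sum X 1\<close>; the handshake lemma follows.\<close>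

lemma sum_deg:
  assumes "finite X" "3 \<le> card X"
  shows "(\<Sum>v\<in>X. int (deg X v)) = 2 * minor_sum X 1"
proof -
  have "int (card X - 2 * 1) * minor_sum X 1 = (\<Sum>v\<in>X. minor_sum (X - {v}) 1)"
    using assms by (intro minor_sum_vertex_deleted) auto
  also have "\<dots> = (\<Sum>v\<in>X. minor_sum X 1 - int (deg X v))"
    by (rule sum.cong) (use assms minor_sum_1 in auto)
  also have "\<dots> = int (card X) * minor_sum X 1 - (\<Sum>v\<in>X. int (deg X v))"
    by (simp add: sum_subtractf)
  finally show ?thesis using assms by (simp add: of_nat_diff algebra_simps)
qed

lemma minor_sum_1_insert_deg:
  assumes "finite Y" "w \<notin> Y"
  shows "minor_sum (insert w Y) 1 = minor_sum Y 1 + int (deg (insert w Y) w)"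
  using minor_sum_1[of "insert w Y" w] assms by simp

lemma minor_sum_1_union_ge:
  assumes "finite Y" "finite Z" "Y \<inter> Z = {}"
  shows "minor_sum Y 1 + minor_sum Z 1 \<le> minor_sum (Y \<union> Z) 1"
  using assms(2,3)
proof (induction Z rule: finite_induct)
  case empty
  have "minor_sum {} 1 = 0" by (rule minor_sum_big) auto
  thus ?case by simp
next
  case (insert w Z)
  have "deg (insert w Z) w \<le> deg (insert w (Y \<union> Z)) w"
    using assms(1) insert by (intro card_mono nbrs_mono finite_nbrs) auto
  moreover have "minor_sum (insert w (Y \<union> Z)) 1 = minor_sum (Y \<union> Z) 1 + int (deg (insert w (Y \<union> Z)) w)"
    using assms(1) insert by (intro minor_sum_1_insert_deg) auto
  ultimately show ?case using insert minor_sum_1_insert_deg[of Z w] by simp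
qed

lemma minor_sum_1_union_greater:
  assumes "finite Y" "finite Z" "Y \<inter> Z = {}" "u \<in> Y" "w \<in> Z" "s u w \<noteq> 0"
  shows "minor_sum Y 1 + minor_sum Z 1 < minor_sum (Y \<union> Z) 1"
proof -
  have "insert u (nbrs Z w) \<subseteq> nbrs (Y \<union> Z) w"
    using assms s_sym_nz[of u w] by (auto simp: nbrs_def)
  hence "card (insert u (nbrs Z w)) \<le> deg (Y \<union> Z) w"
    using assms by (intro card_mono finite_nbrs) auto
  moreover have "u \<notin> nbrs Z w" using assms by (auto simp: nbrs_def)
  ultimately have "deg Z w < deg (Y \<union> Z) w" using assms by (simp add: finite_nbrs)
  moreover have "minor_sum Y 1 + minor_sum (Z - {w}) 1 \<le> minor_sum (Y \<union> (Z - {w})) 1"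
    using assms by (intro minor_sum_1_union_ge) auto
  moreover have "Y \<union> Z - {w} = Y \<union> (Z - {w})" using assms by auto
  ultimately show ?thesis
    using minor_sum_1[of Z w] minor_sum_1[of "Y \<union> Z" w] assms by simp
qed

lemma connected_near_forest:
  assumes fin: "finite V"
    and conn: "\<And>Y. Y \<subseteq> V \<Longrightarrow> Y \<noteq> {} \<Longrightarrow> Y \<noteq> V \<Longrightarrow> \<exists>u\<in>Y. \<exists>w\<in>V - Y. s u w \<noteq> 0"
    and edges: "minor_sum V 1 = int (card V)"
  shows "near_forest V"
proof -
  \<comment> \<open>By connectedness \<open>Y\<close> can be enlarged to \<open>V\<close> one vertex
    at a time, each bringing at least one edge. A surplus of edges over vertices in \<open>Y\<close>
    would persist up to \<open>V\<close>.\<close>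
  have upper: "minor_sum Y 1 \<le> int (card Y)" if "Y \<subseteq> V" "Y \<noteq> {}" for Y
    using that
  proof (induction "card (V - Y)" arbitrary: Y rule: less_induct)
    case less
    show ?case
    proof (cases "Y = V")
      case False
      then obtain u w where uw: "u \<in> Y" "w \<in> V - Y" "s u w \<noteq> 0" using conn less.prems by blast
      have fY: "finite Y" using less.prems fin by (auto dest: finite_subset)
      have "card (V - insert w Y) < card (V - Y)" using uw fin by (intro psubset_card_mono) auto
      hence "minor_sum (insert w Y) 1 \<le> int (card (insert w Y))"
        using less.prems uw by (intro less.hyps) auto
      moreover have "u \<in> nbrs (insert w Y) w" using uw s_sym_nz[of u w] by (simp add: nbrs_def)
      hence "deg (insert w Y) w > 0" using fY by (auto simp: card_gt_0_iff finite_nbrs)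
      ultimately show ?thesis using minor_sum_1_insert_deg[OF fY, of w] uw fY by simp
    qed (use edges in simp)
  qed
  \<comment> \<open>The handshake lemma gives at least \<open>card Y\<close> edges and
    \<open>upper\<close> at most as many, so no degree can exceed two.\<close>
  have core: "minor_sum Y 1 = int (card Y) \<and> (\<forall>u\<in>Y. deg Y u = 2)"
    if Y: "Y \<subseteq> V" "Y \<noteq> {}" "\<forall>u\<in>Y. 2 \<le> deg Y u" for Y
  proof -
    have fY: "finite Y" using Y fin by (auto dest: finite_subset)
    obtain u where u: "u \<in> Y" using Y by auto
    have "nbrs Y u \<subseteq> Y - {u}" by (auto simp: nbrs_def)
    hence "deg Y u \<le> card (Y - {u})" using fY by (intro card_mono) auto
    moreover have "2 \<le> deg Y u" using Y(3) u by blast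
    ultimately have "card Y \<ge> 3" using u fY by simp
    hence sd: "(\<Sum>v\<in>Y. int (deg Y v)) = 2 * minor_sum Y 1" using fY by (rule sum_deg[rotated])
    have "(\<Sum>v\<in>Y. 2) \<le> (\<Sum>v\<in>Y. int (deg Y v))" using Y by (intro sum_mono) auto
    hence eq: "minor_sum Y 1 = int (card Y)" using sd upper[OF Y(1,2)] by simp
    hence "(\<Sum>v\<in>Y. int (deg Y v) - 2) = 0" using sd by (simp add: sum_subtractf)
    hence "\<forall>v\<in>Y. int (deg Y v) - 2 = 0" using fY Y(3) by (subst (asm) sum_nonneg_eq_0_iff) auto
    thus ?thesis using eq by auto
  qed
  \<comment> \<open>\<open>W\<close> grows outside \<open>Z\<close>, keeping at least as many edges
    as vertices, until an edge links it to \<open>Z\<close>. That edge gives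
    \<open>W \<union> Z\<close> more edges than vertices, against \<open>upper\<close>.\<close>
  have disj: False if Z: "Z \<subseteq> V" "Z \<noteq> {}" "\<forall>u\<in>Z. 2 \<le> deg Z u"
    and W: "W \<subseteq> V - Z" "W \<noteq> {}" "minor_sum W 1 \<ge> int (card W)" for Z W
    using W
  proof (induction "card (V - Z - W)" arbitrary: W rule: less_induct)
    case less
    have fW: "finite W" and fZ: "finite Z" using less.prems Z fin by (auto dest: finite_subset)
    obtain u w where uw: "u \<in> W" "w \<in> V - W" "s u w \<noteq> 0"
      using conn[of W] less.prems Z by blast
    show ?case
    proof (cases "w \<in> Z")
      case True
      have "minor_sum W 1 + minor_sum Z 1 < minor_sum (W \<union> Z) 1"
        using less.prems uw True fW fZ by (intro minor_sum_1_union_greater) auto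
      moreover have "card (W \<union> Z) = card W + card Z"
        using less.prems fW fZ by (intro card_Un_disjoint) auto
      moreover have "minor_sum (W \<union> Z) 1 \<le> int (card (W \<union> Z))"
        using less.prems Z by (intro upper) auto
      ultimately show False using core[OF Z] less.prems by simp
    next
      case False
      have "card (V - Z - insert w W) < card (V - Z - W)"
        using uw False fin by (intro psubset_card_mono) auto
      moreover have "u \<in> nbrs (insert w W) w" using uw s_sym_nz[of u w] by (simp add: nbrs_def)
      hence "deg (insert w W) w > 0" using fW by (auto simp: card_gt_0_iff finite_nbrs)
      hence "minor_sum (insert w W) 1 \<ge> int (card (insert w W))"
        using minor_sum_1_insert_deg[OF fW, of w] uw fW less.prems by simp
      ultimately show False using less.prems uw False by (intro less.hyps[of "insert w W"]) auto
    qed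
  qed
  show ?thesis
    unfolding near_forest_def
  proof (intro conjI allI impI)
    fix Y assume Y: "Y \<subseteq> V" "\<forall>u\<in>Y. 2 \<le> deg Y u"
    show "\<forall>u\<in>Y. deg Y u = 2" using core[OF Y(1) _ Y(2)] by (cases "Y = {}") auto
  next
    fix Y Z assume YZ: "Y \<subseteq> V" "Z \<subseteq> V" "Y \<noteq> {} \<and> Z \<noteq> {} \<and> Y \<inter> Z = {}"
    show "(\<exists>u\<in>Y. deg Y u < 2) \<or> (\<exists>u\<in>Z. deg Z u < 2)"
    proof (rule ccontr)
      assume "\<not> ?thesis"
      hence *: "\<forall>u\<in>Y. 2 \<le> deg Y u" "\<forall>u\<in>Z. 2 \<le> deg Z u" by (auto simp: not_less)
      have "minor_sum Y 1 \<ge> int (card Y)" using core[of Y] YZ * by simp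
      thus False using disj[of Z Y] YZ * by blast
    qed
  qed
qed

lemma minor_sum_1_eq_card:
  assumes "finite X"
  shows "minor_sum X 1 = int (card {{u, v} | u v. u \<in> X \<and> v \<in> X \<and> s u v \<noteq> 0})"
proof -
  have "minor_sum X 1 = (\<Sum>Y | Y \<subseteq> X \<and> card Y = 2. minor Y)" by (simp add: minor_sum_def)
  also have "\<dots> = (\<Sum>Y\<in>{{u, v} | u v. u \<in> X \<and> v \<in> X \<and> s u v \<noteq> 0}. 1)"
  proof (rule sum.mono_neutral_cong_right)
    show "finite {Y. Y \<subseteq> X \<and> card Y = 2}" using assms by (auto intro: finite_subset[of _ "Pow X"])
    have ne: "u \<noteq> v" if "s u v \<noteq> 0" for u v using that by auto
    show "{{u, v} | u v. u \<in> X \<and> v \<in> X \<and> s u v \<noteq> 0} \<subseteq> {Y. Y \<subseteq> X \<and> card Y = 2}"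
    proof clarify
      fix u v assume "u \<in> X" "v \<in> X" "s u v \<noteq> 0"
      thus "{u, v} \<subseteq> X \<and> card {u, v} = 2" using ne[of u v] by simp
    qed
    show "\<forall>Y\<in>{Y. Y \<subseteq> X \<and> card Y = 2} - {{u, v} | u v. u \<in> X \<and> v \<in> X \<and> s u v \<noteq> 0}. minor Y = 0"
    proof
      fix Y assume Y: "Y \<in> {Y. Y \<subseteq> X \<and> card Y = 2} - {{u, v} | u v. u \<in> X \<and> v \<in> X \<and> s u v \<noteq> 0}"
      then obtain u v where uv: "Y = {u, v}" "u \<noteq> v" by (auto simp: card_2_iff)
      hence "s u v = 0" using Y by blast
      thus "minor Y = 0" using uv by (simp add: minor_edge)
    qed
    show "minor Y = 1" if "Y \<in> {{u, v} | u v. u \<in> X \<and> v \<in> X \<and> s u v \<noteq> 0}" for Y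
    proof -
      obtain u v where "Y = {u, v}" "s u v \<noteq> 0" using \<open>Y \<in> _\<close> by blast
      thus ?thesis using ne[of u v] by (simp add: minor_edge)
    qed
  qed
  finally show ?thesis by simp
qed

end

section \<open>Oriented graphs as skew forms\<close>

definition arc_sign :: "'a pair_pre_digraph \<Rightarrow> 'a \<Rightarrow> 'a \<Rightarrow> int" where
  "arc_sign D u v = (if (u, v) \<in> parcs D then 1 else if (v, u) \<in> parcs D then -1 else 0)"

lemma skew_form_arc_sign: "asym (parcs D) \<Longrightarrow> skew_form (arc_sign D)"
  by unfold_locales (auto simp: arc_sign_def dest: asymD)

lemma arc_sign_eq_1: "arc_sign D u v = 1 \<longleftrightarrow> (u, v) \<in> parcs D"
  by (simp add: arc_sign_def)

lemma in_parcs_mk_symmetric: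
  "(u, v) \<in> parcs (mk_symmetric (with_proj D)) \<longleftrightarrow> (u, v) \<in> parcs D \<or> (v, u) \<in> parcs D"
  by (auto simp: parcs_mk_symmetric intro: bexI[of _ "(v, u)"])

lemma orientation_of_parcs:
  assumes "orientation_of G D"
  shows "pverts G = pverts D" "(u, v) \<in> parcs G \<longleftrightarrow> arc_sign D u v \<noteq> 0" "asym (parcs D)"
proof -
  have G: "G = mk_symmetric (with_proj D)" and "asym (parcs D)"
    using assms by (auto simp: orientation_of_def)
  show "pverts G = pverts D" by (simp add: G)
  show "(u, v) \<in> parcs G \<longleftrightarrow> arc_sign D u v \<noteq> 0"
    unfolding G in_parcs_mk_symmetric by (simp add: arc_sign_def)
  show "asym (parcs D)" by fact
qed

lemma skew_energy_int_mat:
  "pverts D = {..<n} \<Longrightarrow> skew_energy D = mat_energy (int_mat n (arc_sign D))"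
  by (simp add: skew_energy_def mat_energy_def skew_adj_matrix_def int_mat_def arc_sign_def
      if_distrib[of of_int] cong: if_cong)

lemma edge_set_minor_sum:
  assumes "orientation_of G D" "finite (pverts G)" "parcs G \<subseteq> pverts G \<times> pverts G"
  shows "skew_form.minor_sum (arc_sign D) (pverts G) 1 = int (card (edge_set G))"
proof -
  interpret skew_form "arc_sign D"
    by (rule skew_form_arc_sign[OF orientation_of_parcs(3)[OF assms(1)]])
  have "edge_set G = {{u, v} | u v. u \<in> pverts G \<and> v \<in> pverts G \<and> arc_sign D u v \<noteq> 0}"
    unfolding edge_set_def using assms(3) orientation_of_parcs(2)[OF assms(1)] by blast
  thus ?thesis using minor_sum_1_eq_card[OF assms(2)] by simp
qed

lemma unicyclic_near_forest:
  assumes "unicyclic G" "orientation_of G D"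
  shows "skew_form.near_forest (arc_sign D) (pverts G)"
proof -
  interpret skew_form "arc_sign D"
    by (rule skew_form_arc_sign[OF orientation_of_parcs(3)[OF assms(2)]])
  have G: "pair_graph G" and conn: "Digraph_Component.connected (with_proj G)"
    and card: "card (edge_set G) = card (pverts G)"
    using assms(1) by (auto simp: unicyclic_def)
  interpret G: pair_graph G by fact
  have sub: "parcs G \<subseteq> pverts G \<times> pverts G" using G.in_arcsD1 G.in_arcsD2 by auto
  have sym: "(v, u) \<in> parcs G" if "(u, v) \<in> parcs G" for u v
    using that orientation_of_parcs(2)[OF assms(2)] s_sym_nz by blast
  show ?thesis
  proof (rule connected_near_forest)
    show "finite (pverts G)" by simp
    show "minor_sum (pverts G) 1 = int (card (pverts G))"
      using edge_set_minor_sum[OF assms(2) _ sub] card by simp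
    fix Y assume Y: "Y \<subseteq> pverts G" "Y \<noteq> {}" "Y \<noteq> pverts G"
    then obtain a b where ab: "a \<in> Y" "b \<in> pverts G - Y" by auto
    show "\<exists>u\<in>Y. \<exists>w\<in>pverts G - Y. arc_sign D u w \<noteq> 0"
    proof (rule ccontr)
      assume no: "\<not> ?thesis"
      have "(a, b) \<in> rtrancl_on (pverts G) ((parcs G)\<^sup>s)"
        using conn ab Y unfolding connected_conv by auto
      hence "b \<in> Y"
      proof (induction rule: rtrancl_on_induct)
        case (step y z)
        hence "(y, z) \<in> parcs G" using sym by (auto simp: symcl_def)
        thus ?case using no step orientation_of_parcs(2)[OF assms(2), of y z] by blast
      qed (use ab in auto)
      thus False using ab by simp
    qed
  qed
qed

lemma oriented_unicyclic_facts:
  assumes "D \<in> oriented_unicyclic n"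
  shows "pverts D = {..<n}" "skew_form (arc_sign D)" "skew_form.near_forest (arc_sign D) {..<n}"
    "asym (parcs D)" "parcs D \<subseteq> {..<n} \<times> {..<n}"
proof -
  obtain G where G: "unicyclic G" "pverts G = {..<n}" "orientation_of G D"
    using assms by (auto simp: oriented_unicyclic_def)
  interpret pair_graph G using G by (simp add: unicyclic_def)
  show "pverts D = {..<n}" using G orientation_of_parcs(1) by metis
  show "asym (parcs D)" using orientation_of_parcs(3)[OF G(3)] .
  thus "skew_form (arc_sign D)" by (rule skew_form_arc_sign)
  show "skew_form.near_forest (arc_sign D) {..<n}" using unicyclic_near_forest[OF G(1,3)] G(2) by simp
  show "parcs D \<subseteq> {..<n} \<times> {..<n}"
  proof clarify
    fix u v assume "(u, v) \<in> parcs D"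
    hence "(u, v) \<in> parcs G" using orientation_of_parcs(2)[OF G(3), of u v] by (simp add: arc_sign_def)
    thus "u \<in> {..<n} \<and> v \<in> {..<n}" using in_arcsD1 in_arcsD2 G(2) by blast
  qed
qed

section \<open>The extremal graph as a unicyclic graph with a concrete orientation\<close>

lemma cycle_path_graph_4:
  assumes "n \<ge> 4"
  shows "pverts (cycle_path_graph n 4) = {..<n}"
    "(i, j) \<in> parcs (cycle_path_graph n 4) \<longleftrightarrow> i < n \<and> j < n \<and> extremal_adj i j"
proof -
  have arc: "(i < 4 \<and> j = Suc i mod 4 \<or> 4 \<le> i \<and> Suc i < n \<and> j = Suc i \<or> 4 < n \<and> i = 0 \<and> j = 4) \<longleftrightarrow>
    i < n \<and> j < n \<and> extremal_arc i j" for i j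
  proof -
    have "i < 4 \<and> j = Suc i mod 4 \<Longrightarrow> i < n \<and> j < n" using assms by (auto simp: less_4_iff)
    thus ?thesis unfolding extremal_arc_def by linarith
  qed
  show "pverts (cycle_path_graph n 4) = {..<n}" by (simp add: cycle_path_graph_def)
  have "(i, j) \<in> parcs (cycle_path_graph n 4) \<longleftrightarrow>
    (i < 4 \<and> j = Suc i mod 4 \<or> 4 \<le> i \<and> Suc i < n \<and> j = Suc i \<or> 4 < n \<and> i = 0 \<and> j = 4) \<or>
    (j < 4 \<and> i = Suc j mod 4 \<or> 4 \<le> j \<and> Suc j < n \<and> i = Suc j \<or> 4 < n \<and> j = 0 \<and> i = 4)"
    unfolding cycle_path_graph_def in_parcs_mk_symmetric by auto
  also have "\<dots> \<longleftrightarrow> i < n \<and> j < n \<and> extremal_adj i j"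
    unfolding arc extremal_adj_def by blast
  finally show "(i, j) \<in> parcs (cycle_path_graph n 4) \<longleftrightarrow> i < n \<and> j < n \<and> extremal_adj i j" .
qed

lemma extremal_adj_commute: "extremal_adj i j \<longleftrightarrow> extremal_adj j i"
  by (auto simp: extremal_adj_def)

text \<open>On \<open>cycle_path_graph n 4\<close> this yields the cycle arcs from \<open>0\<close>
  to \<open>1\<close>, \<open>1\<close> to \<open>2\<close>, \<open>2\<close> to \<open>3\<close>
  and \<open>0\<close> to \<open>3\<close>. Exactly one of them runs against the others, so it
  witnesses that an orientation \<open>+\<close> exists.\<close>

definition increasing_orientation :: "'a :: linorder pair_pre_digraph \<Rightarrow> 'a pair_pre_digraph" where
  "increasing_orientation G = \<lparr>pverts = pverts G, parcs = {(u, v) \<in> parcs G. u < v}\<rparr>"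

lemma increasing_orientation_of:
  fixes G :: "'a :: linorder pair_pre_digraph"
  assumes "\<And>u v. (u, v) \<in> parcs G \<Longrightarrow> (v, u) \<in> parcs G" "\<And>u. (u, u) \<notin> parcs G"
  shows "orientation_of G (increasing_orientation G)"
proof -
  have "(u, v) \<in> parcs (mk_symmetric (with_proj (increasing_orientation G))) \<longleftrightarrow> (u, v) \<in> parcs G" for u v
    unfolding in_parcs_mk_symmetric increasing_orientation_def
    using assms(1)[of u v] assms(1)[of v u] assms(2)[of u] by (cases u v rule: linorder_cases) auto
  hence "parcs (mk_symmetric (with_proj (increasing_orientation G))) = parcs G" by auto
  moreover have "asym (parcs (increasing_orientation G))"
    by (rule asymI) (auto simp: increasing_orientation_def)
  moreover have "pverts (mk_symmetric (with_proj (increasing_orientation G))) = pverts G"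
    by (simp add: increasing_orientation_def)
  ultimately show ?thesis by (simp add: orientation_of_def)
qed

lemma extremal_labelling_id:
  assumes "n \<ge> 4" "orientation_of (cycle_path_graph n 4) P"
    and "arc_sign P 0 1 * arc_sign P 1 2 * arc_sign P 2 3 * arc_sign P 3 0 = -1"
  shows "skew_form.extremal_labelling (arc_sign P) (\<lambda>i. i) {..<n} (n - 4)"
proof -
  interpret skew_form "arc_sign P"
    by (rule skew_form_arc_sign[OF orientation_of_parcs(3)[OF assms(2)]])
  have "arc_sign P i j \<noteq> 0 \<longleftrightarrow> extremal_adj i j" if "i < n" "j < n" for i j
    using orientation_of_parcs(2)[OF assms(2), of i j] cycle_path_graph_4(2)[OF assms(1), of i j] that
    by simp
  thus ?thesis using assms(1,3) by (simp add: extremal_labelling_def bij_betw_def)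
qed

lemma increasing_cycle_path_orientation:
  assumes "n \<ge> 4"
  defines "G \<equiv> cycle_path_graph n 4"
  shows "orientation_of G (increasing_orientation G)"
    "(i, j) \<in> parcs (increasing_orientation G) \<longleftrightarrow> i < j \<and> j < n \<and> extremal_adj i j"
    "skew_form.extremal_labelling (arc_sign (increasing_orientation G)) (\<lambda>i. i) {..<n} (n - 4)"
proof -
  show o: "orientation_of G (increasing_orientation G)"
  proof (rule increasing_orientation_of)
    show "(v, u) \<in> parcs G" if "(u, v) \<in> parcs G" for u v
      using that cycle_path_graph_4(2)[OF assms(1)] extremal_adj_commute[of u v] by (simp add: G_def)
    show "(u, u) \<notin> parcs G" for u
      using cycle_path_graph_4(2)[OF assms(1)] not_extremal_adj_self[of u] by (simp add: G_def)
  qed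
  show p: "(i, j) \<in> parcs (increasing_orientation G) \<longleftrightarrow> i < j \<and> j < n \<and> extremal_adj i j" for i j
    using cycle_path_graph_4(2)[OF assms(1), of i j] by (auto simp: increasing_orientation_def G_def)
  show "skew_form.extremal_labelling (arc_sign (increasing_orientation G)) (\<lambda>i. i) {..<n} (n - 4)"
    using assms(1) o
    by (intro extremal_labelling_id) (simp_all add: G_def[symmetric] arc_sign_def p extremal_adj_less_4)
qed

lemma unicyclic_cycle_path_graph:
  assumes "n \<ge> 4"
  shows "unicyclic (cycle_path_graph n 4)"
proof -
  let ?G = "cycle_path_graph n 4"
  let ?P = "increasing_orientation ?G"
  note G = cycle_path_graph_4[OF assms]
  note P = increasing_cycle_path_orientation[OF assms]
  have sub: "parcs ?G \<subseteq> pverts ?G \<times> pverts ?G" using G by auto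
  have fin: "finite (pverts ?G)" using G by simp
  have sym: "sym (parcs ?G)" using G(2) extremal_adj_commute by (auto intro!: symI)
  have pg: "pair_graph ?G"
  proof
    fix e assume e: "e \<in> parcs ?G"
    show "fst e \<in> pverts ?G" "snd e \<in> pverts ?G" using e sub by auto
    show "fst e \<noteq> snd e" using e G(2)[of "fst e" "snd e"] not_extremal_adj_self[of "fst e"] by auto
  next
    show "finite (pverts ?G)" by fact
    show "finite (parcs ?G)" using sub fin by (auto intro: finite_subset)
    show "symmetric (with_proj ?G)" using sym by (simp add: symmetric_def)
  qed
  have root: "(0, i) \<in> rtrancl_on (pverts ?G) ((parcs ?G)\<^sup>s)" if "i < n" for i
    using that
  proof (induction i rule: less_induct)
    case (less i)
    show ?case
    proof (cases i)
      case 0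
      thus ?thesis using less G(1) by simp
    next
      case (Suc k)
      \<comment> \<open>The parent of \<open>i\<close> in a spanning tree rooted at
        \<open>0\<close>; the vertex \<open>4\<close> hangs from \<open>0\<close>, not from
        \<open>3\<close>.\<close>
      define p where "p = (if i = 4 then 0 else k)"
      have "extremal_adj p i"
        using Suc by (auto simp: p_def extremal_adj_def extremal_arc_def)
      hence "(p, i) \<in> parcs ?G" using G(2)[of p i] less.prems Suc by (auto simp: p_def)
      moreover have "(0, p) \<in> rtrancl_on (pverts ?G) ((parcs ?G)\<^sup>s)"
        using less Suc by (intro less.IH) (auto simp: p_def)
      ultimately show ?thesis using less.prems G(1)
        by (auto simp: symcl_def intro: rtrancl_on_into_rtrancl_on)
    qed
  qed
  have "sym (rtrancl_on (pverts ?G) ((parcs ?G)\<^sup>s))"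
    using sym by (intro rtrancl_on_sym) (auto simp: sym_def symcl_def)
  hence reach: "(i, j) \<in> rtrancl_on (pverts ?G) ((parcs ?G)\<^sup>s)" if "i < n" "j < n" for i j
    using root[OF that(1)] root[OF that(2)] rtrancl_on_trans by (metis symD)
  have conn: "Digraph_Component.connected (with_proj ?G)"
  proof -
    have "0 \<in> {..<n}" using assms by simp
    thus ?thesis
      unfolding connected_conv using G(1) reach by auto
  qed
  interpret skew_form "arc_sign ?P"
    by (rule skew_form_arc_sign[OF orientation_of_parcs(3)[OF P(1)]])
  \<comment> \<open>The number of edges is read off from the coefficient with \<open>j = 1\<close>,
    which is already known.\<close>
  have "minor_sum (pverts ?G) 1 = int n"
    using extremal_labelling_minor_sum[OF P(3), of 1] assms G(1) by (simp add: extremal_count_1)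
  hence "card (edge_set ?G) = card (pverts ?G)"
    using edge_set_minor_sum[OF P(1) fin sub] G(1) by simp
  thus ?thesis using pg conn by (simp add: unicyclic_def)
qed

lemma plus_orientation_increasing:
  assumes "n \<ge> 4"
  shows "plus_orientation (cycle_path_graph n 4) (increasing_orientation (cycle_path_graph n 4))"
proof -
  let ?G = "cycle_path_graph n 4" and ?c = "[0, 1, 2, 3 :: nat]"
  note P = increasing_cycle_path_orientation[OF assms]
  have "is_graph_cycle ?G ?c"
    unfolding is_graph_cycle_def
  proof (intro conjI allI impI)
    fix i assume "i < length ?c"
    hence "i = 0 \<or> i = 1 \<or> i = 2 \<or> i = 3" by (simp, linarith)
    thus "(?c ! i, ?c ! (Suc i mod length ?c)) \<in> parcs ?G"
      using cycle_path_graph_4(2)[OF assms] assms by (elim disjE) (simp_all add: extremal_adj_less_4)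
  qed simp_all
  moreover have "{i. i < length ?c \<and> (?c ! (Suc i mod length ?c), ?c ! i) \<in> parcs (increasing_orientation ?G)} = {3}"
  proof (rule Set.set_eqI)
    fix i :: nat
    show "i \<in> {i. i < length ?c \<and> (?c ! (Suc i mod length ?c), ?c ! i) \<in> parcs (increasing_orientation ?G)} \<longleftrightarrow> i \<in> {3}"
    proof (cases "i < 4")
      case True
      hence "i = 0 \<or> i = 1 \<or> i = 2 \<or> i = 3" by (simp add: less_4_iff)
      thus ?thesis using P(2) assms by (elim disjE) (simp_all add: extremal_adj_less_4)
    qed auto
  qed
  ultimately show ?thesis
    unfolding plus_orientation_def using unicyclic_cycle_path_graph[OF assms] P(1) by fastforce
qed

section \<open>Cycles of the extremal graph and their sign\<close>

lemma extremal_adj_less_4_mod: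
  assumes "extremal_adj i j" "i < 4" "j < 4"
  shows "j = Suc i mod 4 \<or> j = (i + 3) mod 4"
proof -
  have "i = 0 \<or> i = 1 \<or> i = 2 \<or> i = 3" "j = 0 \<or> j = 1 \<or> j = 2 \<or> j = 3"
    using assms less_4_iff by auto
  thus ?thesis using assms(1) by (elim disjE) (simp_all add: extremal_adj_less_4)
qed

lemma extremal_adj_less_4_parity:
  assumes "extremal_adj i j" "i < 4" "j < 4"
  shows "even i \<longleftrightarrow> odd j"
proof -
  have "i = 0 \<or> i = 1 \<or> i = 2 \<or> i = 3" using assms less_4_iff by auto
  thus ?thesis using extremal_adj_less_4_mod[OF assms] by (elim disjE) simp_all
qed

text \<open>The cycle can be traversed from four starting points in two senses. Reversal changes
  four signs, an even number, so the product stays the same.\<close>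

lemma extremal_four_cycle_sign:
  fixes t :: "nat \<Rightarrow> nat \<Rightarrow> int"
  assumes t: "\<And>i j. t j i = - t i j"
    and less: "w < 4" "x < 4" "y < 4" "z < 4" and ne: "w \<noteq> y" "x \<noteq> z"
    and adj: "extremal_adj w x" "extremal_adj x y" "extremal_adj w z"
  shows "t w x * t x y * t y z * t z w = t 0 1 * t 1 2 * t 2 3 * t 3 0"
proof -
  have t': "t 1 0 = - t 0 1" "t 2 1 = - t 1 2" "t 3 2 = - t 2 3" "t 0 3 = - t 3 0" by (rule t)+
  have "w = 0 \<or> w = 1 \<or> w = 2 \<or> w = 3" using less less_4_iff by auto
  moreover have "x = Suc w mod 4 \<or> x = (w + 3) mod 4" "y = Suc x mod 4 \<or> y = (x + 3) mod 4"
    "z = Suc w mod 4 \<or> z = (w + 3) mod 4"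
    using extremal_adj_less_4_mod less adj by auto
  ultimately have "(w, x, y, z) \<in>
    {(0,1,2,3), (1,2,3,0), (2,3,0,1), (3,0,1,2), (0,3,2,1), (3,2,1,0), (2,1,0,3), (1,0,3,2)}"
    using ne by (elim disjE) simp_all
  hence "(w = 0 \<and> x = 1 \<and> y = 2 \<and> z = 3) \<or> (w = 1 \<and> x = 2 \<and> y = 3 \<and> z = 0) \<or>
    (w = 2 \<and> x = 3 \<and> y = 0 \<and> z = 1) \<or> (w = 3 \<and> x = 0 \<and> y = 1 \<and> z = 2) \<or>
    (w = 0 \<and> x = 3 \<and> y = 2 \<and> z = 1) \<or> (w = 3 \<and> x = 2 \<and> y = 1 \<and> z = 0) \<or>
    (w = 2 \<and> x = 1 \<and> y = 0 \<and> z = 3) \<or> (w = 1 \<and> x = 0 \<and> y = 3 \<and> z = 2)" by simp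
  thus ?thesis by (elim disjE conjE) (simp_all only: t' mult_minus_left mult_minus_right minus_minus ac_simps)
qed

text \<open>The largest vertex of a cycle that enters the path would have only one neighbour below
  it, but two distinct ones on the cycle.\<close>

lemma extremal_cycle_vertices:
  assumes "3 \<le> length c" "distinct c" "\<And>i. i < length c \<Longrightarrow> extremal_adj (c ! i) (c ! (Suc i mod length c))"
    and "v \<in> set c"
  shows "v < 4"
proof (rule ccontr)
  assume "\<not> v < 4"
  define m where "m = Max (set c)"
  have m: "m \<in> set c" unfolding m_def using assms(4) by (intro Max_in) auto
  have m_max: "w \<le> m" if "w \<in> set c" for w using that by (simp add: m_def)
  have m4: "m \<ge> 4" using m_max[OF assms(4)] \<open>\<not> v < 4\<close> by simp
  obtain i where i: "i < length c" "c ! i = m" using m by (auto simp: in_set_conv_nth)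
  let ?l = "length c"
  define a where "a = Suc i mod ?l"
  define b where "b = (if i = 0 then ?l - 1 else i - 1)"
  have ab: "a < ?l" "b < ?l" "Suc b mod ?l = i" "a \<noteq> b" "a \<noteq> i" "b \<noteq> i"
    using i assms(1) by (auto simp: a_def b_def mod_Suc)
  have only: "w = (if m = 4 then 0 else m - 1)" if "extremal_adj m w" "w \<le> m" for w
    using that m4 not_extremal_adj_self[of m] by (auto simp: extremal_adj_def extremal_arc_def less_4_iff)
  have "extremal_adj m (c ! a)" using assms(3)[OF i(1)] i by (simp add: a_def)
  moreover have "extremal_adj m (c ! b)"
    using assms(3)[OF ab(2)] ab(3) i extremal_adj_commute by simp
  ultimately have "c ! a = c ! b" using only m_max ab by (metis nth_mem)
  thus False using assms(2) ab by (simp add: nth_eq_iff_index_eq)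
qed

text \<open>The cycle in \<open>plus_orientation\<close> is arbitrary and must be identified: it
  lies in \<open>{..<4}\<close>, and as the graph is bipartite there its length is not
  \<open>3\<close>. A single backward arc then gives the product \<open>-1\<close>.\<close>

lemma plus_orientation_sign:
  assumes "n \<ge> 4" "plus_orientation (cycle_path_graph n 4) P"
  shows "arc_sign P 0 1 * arc_sign P 1 2 * arc_sign P 2 3 * arc_sign P 3 0 = -1"
proof -
  let ?G = "cycle_path_graph n 4"
  obtain c where P: "orientation_of ?G P" and c: "is_graph_cycle ?G c"
    and one: "card {i. i < length c \<and> (c ! (Suc i mod length c), c ! i) \<in> parcs P} = 1"
    using assms(2) by (auto simp: plus_orientation_def)
  interpret skew_form "arc_sign P"
    by (rule skew_form_arc_sign[OF orientation_of_parcs(3)[OF P]])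
  let ?l = "length c"
  have c3: "3 \<le> ?l" "distinct c" using c by (auto simp: is_graph_cycle_def)
  have adj: "extremal_adj (c ! i) (c ! (Suc i mod ?l))"
    and nz: "arc_sign P (c ! i) (c ! (Suc i mod ?l)) \<noteq> 0" if "i < ?l" for i
    using c that cycle_path_graph_4(2)[OF assms(1)] orientation_of_parcs(2)[OF P]
    by (auto simp: is_graph_cycle_def)
  have lt: "v < 4" if "v \<in> set c" for v using extremal_cycle_vertices[OF c3 adj that] .
  hence "set c \<subseteq> {..<4}" by auto
  hence "card (set c) \<le> card {..<4::nat}" by (intro card_mono) auto
  hence "?l \<le> 4" using distinct_card[OF c3(2)] by simp
  moreover have "?l \<noteq> 3"
  proof
    assume l: "?l = 3"
    then obtain x y z where xyz: "c = [x, y, z]" by (auto simp: numeral_3_eq_3 length_Suc_conv)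
    have "extremal_adj x y" "extremal_adj y z" "extremal_adj z x"
      using adj[of 0] adj[of 1] adj[of 2] l xyz by simp_all
    moreover have "x < 4" "y < 4" "z < 4" using lt xyz by simp_all
    ultimately show False using extremal_adj_less_4_parity by blast
  qed
  ultimately have l: "?l = 4" using c3 by linarith
  then obtain w x y z where wxyz: "c = [w, x, y, z]" by (auto simp: eval_nat_numeral length_Suc_conv)
  have num: "Suc 0 mod 4 = (1::nat)" "Suc 1 mod 4 = (2::nat)" "Suc 2 mod 4 = (3::nat)" "Suc 3 mod 4 = (0::nat)"
    by simp_all
  have nth: "c ! 0 = w" "c ! 1 = x" "c ! 2 = y" "c ! 3 = z" using wxyz by simp_all
  have ad: "extremal_adj w x" "extremal_adj x y" "extremal_adj y z" "extremal_adj z w"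
    using adj[of 0, unfolded l num nth] adj[of 1, unfolded l num nth] adj[of 2, unfolded l num nth]
      adj[of 3, unfolded l num nth] by simp_all
  let ?B = "\<lambda>i. (c ! (Suc i mod 4), c ! i) \<in> parcs P"
  have sgn: "arc_sign P (c ! i) (c ! (Suc i mod 4)) = (if ?B i then -1 else 1)" if "i < 4" for i
    using nz[of i] that l orientation_of_parcs(3)[OF P] by (auto simp: arc_sign_def dest: asymD split: if_splits)
  have "{i. i < ?l \<and> (c ! (Suc i mod ?l), c ! i) \<in> parcs P} = {i \<in> {..<4}. ?B i}" using l by auto
  hence "card {i \<in> {..<4::nat}. ?B i} = 1" using one by simp
  hence prod: "(\<Prod>i<4. arc_sign P (c ! i) (c ! (Suc i mod 4))) = -1"
    by (simp add: sgn prod.If_cases Int_def)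
  have four: "(\<Prod>i<4. g i) = g 0 * g 1 * g 2 * g 3" for g :: "nat \<Rightarrow> int"
    by (simp add: eval_nat_numeral)
  have sign_c: "arc_sign P w x * arc_sign P x y * arc_sign P y z * arc_sign P z w = -1"
    using prod unfolding four num nth .
  have "w < 4" "x < 4" "y < 4" "z < 4" "w \<noteq> y" "x \<noteq> z" using lt c3 wxyz by auto
  hence eq: "arc_sign P w x * arc_sign P x y * arc_sign P y z * arc_sign P z w =
      arc_sign P 0 1 * arc_sign P 1 2 * arc_sign P 2 3 * arc_sign P 3 0"
    using skew ad extremal_adj_commute by (intro extremal_four_cycle_sign) blast+
  show ?thesis using sign_c unfolding eq .
qed

section \<open>Switching\<close>

lemma arc_sign_switching:
  assumes "asym (parcs D)"
  shows "arc_sign (switching W D) u v = (if u \<in> W \<longleftrightarrow> v \<in> W then 1 else -1) * arc_sign D u v"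
  using assms by (auto simp: arc_sign_def switching_def dest: asymD)

lemma pverts_switching [simp]: "pverts (switching W D) = pverts D"
  by (simp add: switching_def)

lemma asym_switching: "asym (parcs D) \<Longrightarrow> asym (parcs (switching W D))"
  by (rule asymI) (auto simp: switching_def dest: asymD split: if_splits)

text \<open>Switching multiplies the sign of an edge by a factor for each end. Around the 4-cycle
  every vertex contributes its factor twice, so the sign product survives.\<close>

lemma extremal_labelling_switching:
  assumes "asym (parcs D)"
  shows "skew_form.extremal_labelling (arc_sign (switching W D)) f X m \<longleftrightarrow>
    skew_form.extremal_labelling (arc_sign D) f X m"
proof -
  interpret D: skew_form "arc_sign D" by (rule skew_form_arc_sign) fact
  interpret H: skew_form "arc_sign (switching W D)"
    by (rule skew_form_arc_sign, rule asym_switching) fact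
  define e where "e u = (if u \<in> W then -1 else 1 :: int)" for u
  have H: "arc_sign (switching W D) u v = e u * e v * arc_sign D u v" for u v
    unfolding arc_sign_switching[OF assms] by (simp add: e_def)
  have e1: "e u * (e u * x) = x" "e u \<noteq> 0" for u x by (auto simp: e_def)
  have "arc_sign (switching W D) a b * arc_sign (switching W D) b c * arc_sign (switching W D) c d *
      arc_sign (switching W D) d a = arc_sign D a b * arc_sign D b c * arc_sign D c d * arc_sign D d a"
    for a b c d
    unfolding H by (simp add: ac_simps e1)
  moreover have "arc_sign (switching W D) u v \<noteq> 0 \<longleftrightarrow> arc_sign D u v \<noteq> 0" for u v
    unfolding H using e1(2) by simp
  ultimately show ?thesis
    unfolding D.extremal_labelling_def H.extremal_labelling_def by (simp only:)
qed

lemma extremal_labelling_switching_equivalent: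
  assumes "switching_equivalent D H" "asym (parcs D)"
  shows "asym (parcs H) \<and> pverts H = pverts D \<and>
    (skew_form.extremal_labelling (arc_sign H) f X m \<longleftrightarrow>
     skew_form.extremal_labelling (arc_sign D) f X m)"
  using assms(1) unfolding switching_equivalent_def
proof (induction rule: rtranclp_induct)
  case base
  thus ?case using assms(2) by simp
next
  case (step H K)
  then obtain W where K: "K = switching W H" by auto
  show ?case unfolding K using step.IH asym_switching[of H W] extremal_labelling_switching[of H W f X m] by auto
qed

text \<open>
  A switching function along the spanning tree of \<open>P\<^sub>n\<^sup>4\<close> that omits the edge \<open>{3, 0}\<close>.
\<close>

fun tree_sign :: "(nat \<Rightarrow> nat \<Rightarrow> int) \<Rightarrow> nat \<Rightarrow> int" where
  "tree_sign r 0 = 1"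
| "tree_sign r (Suc k) = (if k = 3 then tree_sign r 0 * r 0 4 else tree_sign r k * r k (Suc k))"

lemma tree_sign_square:
  assumes "\<And>i j. extremal_adj i j \<Longrightarrow> i < n \<Longrightarrow> j < n \<Longrightarrow> r i j * r i j = 1" "i < n"
  shows "tree_sign r i * tree_sign r i = 1"
  using assms(2)
proof (induction i)
  case (Suc k)
  let ?p = "if k = 3 then 0 else k"
  have "extremal_adj ?p (Suc k)"
    by (auto simp: extremal_adj_def extremal_arc_def)
  hence "r ?p (Suc k) * r ?p (Suc k) = 1" using assms(1) Suc.prems by (simp split: if_splits)
  moreover have "tree_sign r ?p * tree_sign r ?p = 1" using Suc by simp
  moreover have "tree_sign r (Suc k) = tree_sign r ?p * r ?p (Suc k)" by (simp add: eval_nat_numeral)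
  moreover have "(a * b) * (a * b) = (a * a) * (b * b)" for a b :: int by (simp add: ac_simps)
  ultimately show ?case by (simp only:)
qed simp

text \<open>Along the tree the equation holds by construction; for the omitted edge
  \<open>{3, 0}\<close> it is the condition \<open>cyc\<close> on the product around the
  cycle.\<close>

lemma tree_sign_edge:
  assumes sq: "\<And>i j. extremal_adj i j \<Longrightarrow> i < n \<Longrightarrow> j < n \<Longrightarrow> r i j * r i j = 1"
    and sym: "\<And>i j. r i j = r j i" and cyc: "r 0 1 * r 1 2 * r 2 3 * r 3 0 = 1" and n: "n \<ge> 4"
    and ij: "extremal_adj i j" "i < n" "j < n"
  shows "r i j = tree_sign r i * tree_sign r j"
proof -
  have sq': "tree_sign r i * (tree_sign r i * x) = x" if "i < n" for i x
    using tree_sign_square[of n r i, OF sq that] by (simp add: mult.assoc[symmetric])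
  have arc: "r i j = tree_sign r i * tree_sign r j" if a: "extremal_arc i j" and lt: "i < n" "j < n" for i j
  proof (cases "i = 3")
    case True
    hence j: "j = 0" using a by (simp add: extremal_arc_def)
    have t: "tree_sign r 3 = r 0 1 * r 1 2 * r 2 3" by (simp add: eval_nat_numeral)
    have "extremal_adj 3 0" by (simp add: extremal_adj_def extremal_arc_def)
    hence "r 3 0 * r 3 0 = 1" using sq n by simp
    hence "r 0 1 * r 1 2 * r 2 3 = (r 0 1 * r 1 2 * r 2 3) * (r 3 0 * r 3 0)" by simp
    also have "\<dots> = (r 0 1 * r 1 2 * r 2 3 * r 3 0) * r 3 0" by (simp only: ac_simps)
    also have "\<dots> = r 3 0" using cyc by simp
    finally show ?thesis using t True j by simp
  next
    case False
    show ?thesis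
    proof (cases "i = 0 \<and> j = 4")
      case True
      thus ?thesis by (simp add: eval_nat_numeral)
    next
      case F: False
      have "j = Suc i" using a False F unfolding extremal_arc_def
        by (auto simp: less_4_iff)
      moreover have "i \<noteq> 3" by fact
      ultimately show ?thesis using sq'[OF lt(1)] by simp
    qed
  qed
  show ?thesis
    using ij arc[of i j] arc[of j i] sym[of i j] by (auto simp: extremal_adj_def mult.commute)
qed

section \<open>Isomorphisms of oriented graphs and transport of labellings\<close>

lemma digraph_iso_pairI:
  fixes H P :: "nat pair_pre_digraph"
  assumes "bij_betw g (pverts H) (pverts P)" "parcs H \<subseteq> pverts H \<times> pverts H" "parcs P \<subseteq> pverts P \<times> pverts P"
    and "\<And>u v. u \<in> pverts H \<Longrightarrow> v \<in> pverts H \<Longrightarrow> (u, v) \<in> parcs H \<longleftrightarrow> (g u, g v) \<in> parcs P"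
  shows "digraph_iso (with_proj H) (with_proj P)"
proof -
  define hom where "hom = \<lparr>iso_verts = g, iso_arcs = map_prod g g, iso_head = snd, iso_tail = fst\<rparr>"
  have inj: "inj_on g (pverts H)" and im: "g ` pverts H = pverts P"
    using assms(1) by (auto simp: bij_betw_def)
  have "wf_digraph (with_proj H)"
    using assms(2) by (auto simp: wf_digraph_def)
  moreover have "inj_on (map_prod g g) (parcs H)"
    using map_prod_inj_on[OF inj inj] assms(2) by (rule inj_on_subset)
  ultimately have "pre_digraph.digraph_isomorphism (with_proj H) hom"
    using inj by (simp add: pre_digraph.digraph_isomorphism_def hom_def)
  moreover have "map_prod g g ` parcs H = parcs P"
  proof (intro equalityI subsetI)
    fix e assume "e \<in> map_prod g g ` parcs H"
    thus "e \<in> parcs P" using assms(2,4) by auto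
  next
    fix e assume e: "e \<in> parcs P"
    then obtain a b where ab: "e = (a, b)" "a \<in> g ` pverts H" "b \<in> g ` pverts H"
      using assms(3) im by (cases e) auto
    then obtain u v where "u \<in> pverts H" "v \<in> pverts H" "a = g u" "b = g v" by auto
    thus "e \<in> map_prod g g ` parcs H" using assms(4) e ab by (auto intro!: rev_image_eqI[of "(u, v)"])
  qed
  hence "with_proj P = app_iso hom (with_proj H)"
    using im by (simp add: app_iso_def hom_def with_proj_def)
  ultimately show ?thesis unfolding digraph_iso_def by blast
qed

text \<open>A library isomorphism has separate maps for vertices, arcs, heads and tails. As head and
  tail in \<open>with_proj P\<close> are the projections, the map on arcs is determined by the one
  on vertices.\<close>

lemma digraph_iso_pairD:
  assumes "digraph_iso (with_proj H) (with_proj P)"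
  obtains g where "bij_betw g (pverts H) (pverts P)" "parcs H \<subseteq> pverts H \<times> pverts H"
    "\<And>u v. u \<in> pverts H \<Longrightarrow> v \<in> pverts H \<Longrightarrow> (u, v) \<in> parcs H \<longleftrightarrow> (g u, g v) \<in> parcs P"
proof -
  obtain hom where hom: "pre_digraph.digraph_isomorphism (with_proj H) hom"
    and P: "with_proj P = app_iso hom (with_proj H)"
    using assms by (auto simp: digraph_iso_def)
  define g where "g = iso_verts hom"
  have wf: "wf_digraph (with_proj H)" and inj: "inj_on g (pverts H)"
    and arc: "\<And>a. a \<in> parcs H \<Longrightarrow> g (fst a) = iso_tail hom (iso_arcs hom a) \<and> g (snd a) = iso_head hom (iso_arcs hom a)"
    using hom by (auto simp: pre_digraph.digraph_isomorphism_def g_def)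
  have PP: "pverts P = g ` pverts H" "parcs P = iso_arcs hom ` parcs H" "fst = iso_tail hom" "snd = iso_head hom"
    using arg_cong[OF P, of verts] arg_cong[OF P, of arcs] arg_cong[OF P, of tail] arg_cong[OF P, of head]
    by (simp_all add: g_def)
  have ia: "iso_arcs hom a = (g (fst a), g (snd a))" if "a \<in> parcs H" for a
    using arc[OF that] unfolding PP(3,4)[symmetric] by (simp add: prod_eq_iff)
  have sub: "parcs H \<subseteq> pverts H \<times> pverts H"
  proof
    fix e assume "e \<in> parcs H"
    thus "e \<in> pverts H \<times> pverts H"
      using wf_digraph.tail_in_verts[OF wf, of e] wf_digraph.head_in_verts[OF wf, of e]
      by (simp add: mem_Times_iff)
  qed
  have "(u, v) \<in> parcs H \<longleftrightarrow> (g u, g v) \<in> parcs P" if uv: "u \<in> pverts H" "v \<in> pverts H" for u v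
  proof
    assume "(u, v) \<in> parcs H"
    thus "(g u, g v) \<in> parcs P" using ia[of "(u, v)"] unfolding PP(2) by force
  next
    assume "(g u, g v) \<in> parcs P"
    then obtain a where a: "a \<in> parcs H" "(g u, g v) = (g (fst a), g (snd a))"
      using ia unfolding PP(2) by auto
    have "fst a \<in> pverts H" "snd a \<in> pverts H" using a(1) sub by (auto simp: mem_Times_iff)
    hence "fst a = u" "snd a = v" using a(2) uv inj_onD[OF inj] by (metis prod.inject)+
    hence "a = (u, v)" by (simp add: prod_eq_iff)
    thus "(u, v) \<in> parcs H" using a(1) by simp
  qed
  moreover have "bij_betw g (pverts H) (pverts P)" using inj PP(1) by (simp add: bij_betw_def)
  ultimately show ?thesis using that sub by blast
qed

text \<open>The quotient \<open>r\<close> of the two sign patterns has product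
  \<open>(-1) * (-1) = 1\<close> around the cycle, so it splits into vertex factors. Switching
  \<open>D\<close> at the vertices with factor \<open>-1\<close> makes the patterns equal, and the
  inverse of \<open>f\<close> is the isomorphism.\<close>

lemma extremal_labelling_iso:
  assumes D: "asym (parcs D)" "pverts D = {..<n}" "parcs D \<subseteq> {..<n} \<times> {..<n}"
    and P: "asym (parcs P)" "pverts P = {..<n}" "parcs P \<subseteq> {..<n} \<times> {..<n}"
    and n: "n \<ge> 4"
    and fD: "skew_form.extremal_labelling (arc_sign D) f {..<n} (n - 4)"
    and fP: "skew_form.extremal_labelling (arc_sign P) (\<lambda>i. i) {..<n} (n - 4)"
  shows "\<exists>H. switching_equivalent D H \<and> digraph_iso (with_proj H) (with_proj P)"
proof -
  interpret D: skew_form "arc_sign D" by (rule skew_form_arc_sign) fact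
  interpret P: skew_form "arc_sign P" by (rule skew_form_arc_sign) fact
  have f: "bij_betw f {..<n} {..<n}" and fadj: "\<And>i j. i < n \<Longrightarrow> j < n \<Longrightarrow> arc_sign D (f i) (f j) \<noteq> 0 \<longleftrightarrow> extremal_adj i j"
    and fc: "arc_sign D (f 0) (f 1) * arc_sign D (f 1) (f 2) * arc_sign D (f 2) (f 3) * arc_sign D (f 3) (f 0) = -1"
    using fD n by (auto simp: D.extremal_labelling_def)
  have padj: "\<And>i j. i < n \<Longrightarrow> j < n \<Longrightarrow> arc_sign P i j \<noteq> 0 \<longleftrightarrow> extremal_adj i j"
    and pc: "arc_sign P 0 1 * arc_sign P 1 2 * arc_sign P 2 3 * arc_sign P 3 0 = -1"
    using fP n by (auto simp: P.extremal_labelling_def)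
  define r where "r i j = arc_sign P i j * arc_sign D (f i) (f j)" for i j
  have rr: "(a * b) * (a * b) = (a * a) * (b * b)" for a b :: int by (simp add: ac_simps)
  have r_sq: "r i j * r i j = 1" if "extremal_adj i j" "i < n" "j < n" for i j
    unfolding r_def rr using that fadj padj D.s_square P.s_square by simp
  have r_sym: "r i j = r j i" for i j
    unfolding r_def by (subst P.skew, subst D.skew) simp
  have "r 0 1 * r 1 2 * r 2 3 * r 3 0 =
    (arc_sign P 0 1 * arc_sign P 1 2 * arc_sign P 2 3 * arc_sign P 3 0) *
    (arc_sign D (f 0) (f 1) * arc_sign D (f 1) (f 2) * arc_sign D (f 2) (f 3) * arc_sign D (f 3) (f 0))"
    unfolding r_def by (simp only: ac_simps)
  also have "\<dots> = 1" unfolding fc pc by simp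
  finally have r_cyc: "r 0 1 * r 1 2 * r 2 3 * r 3 0 = 1" .
  let ?e = "tree_sign r"
  have re: "r i j = ?e i * ?e j" if "extremal_adj i j" "i < n" "j < n" for i j
    using r_sq r_sym r_cyc n that by (rule tree_sign_edge)
  have e1: "?e i = 1 \<or> ?e i = -1" if "i < n" for i
    using tree_sign_square[of n r i, OF r_sq that] by (auto simp: zmult_eq_1_iff)
  define W where "W = f ` {i. i < n \<and> ?e i = -1}"
  define H where "H = switching W D"
  have WW: "f i \<in> W \<longleftrightarrow> ?e i = -1" if "i < n" for i
    using f that by (auto simp: W_def bij_betw_def inj_on_def)
  have sign: "arc_sign H (f i) (f j) = arc_sign P i j" if ij: "i < n" "j < n" for i j
  proof (cases "extremal_adj i j")
    case True
    have "arc_sign H (f i) (f j) = ?e i * ?e j * arc_sign D (f i) (f j)"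
      unfolding H_def arc_sign_switching[OF D(1)] using WW ij e1[OF ij(1)] e1[OF ij(2)] by auto
    also have "\<dots> = arc_sign P i j * (arc_sign D (f i) (f j) * arc_sign D (f i) (f j))"
      using re[OF True ij] by (simp add: r_def)
    also have "arc_sign D (f i) (f j) * arc_sign D (f i) (f j) = 1"
      using fadj[OF ij] True by (intro D.s_square) simp
    finally show ?thesis by simp
  next
    case False
    thus ?thesis unfolding H_def arc_sign_switching[OF D(1)] using fadj[OF ij] padj[OF ij] by simp
  qed
  define g where "g = the_inv_into {..<n} f"
  have g: "bij_betw g {..<n} {..<n}" unfolding g_def using f by (rule bij_betw_the_inv_into)
  have fg: "f (g u) = u" "g u < n" if "u < n" for u
    using that f g f_the_inv_into_f_bij_betw[OF f, of u] by (auto simp: g_def bij_betw_def)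
  have "digraph_iso (with_proj H) (with_proj P)"
  proof (rule digraph_iso_pairI)
    show "bij_betw g (pverts H) (pverts P)" using g D(2) P(2) by (simp add: H_def)
    show "parcs H \<subseteq> pverts H \<times> pverts H" using D(2,3) by (auto simp: H_def switching_def split: if_splits)
    show "parcs P \<subseteq> pverts P \<times> pverts P" using P by simp
    fix u v assume "u \<in> pverts H" "v \<in> pverts H"
    hence uv: "u < n" "v < n" using D(2) by (auto simp: H_def)
    have "(u, v) \<in> parcs H \<longleftrightarrow> arc_sign H (f (g u)) (f (g v)) = 1"
      using uv by (simp add: fg arc_sign_eq_1)
    also have "\<dots> \<longleftrightarrow> arc_sign P (g u) (g v) = 1" using sign[of "g u" "g v"] uv by (simp add: fg)
    finally show "(u, v) \<in> parcs H \<longleftrightarrow> (g u, g v) \<in> parcs P" by (simp add: arc_sign_eq_1)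
  qed
  moreover have "switching_equivalent D H"
    unfolding switching_equivalent_def H_def
  proof (rule r_into_rtranclp)
    have "W \<subseteq> pverts D" using f D(2) by (auto simp: W_def bij_betw_def)
    thus "\<exists>W'\<subseteq>pverts D. switching W D = switching W' D" by blast
  qed
  ultimately show ?thesis by blast
qed

text \<open>The identity labelling of \<open>P\<close> is pulled back to \<open>H\<close> along the
  isomorphism; switching preserves labellings, so it also labels \<open>D\<close>.\<close>

lemma iso_extremal_labelling:
  assumes D: "asym (parcs D)" "pverts D = {..<n}" and P: "asym (parcs P)" "pverts P = {..<n}"
    and n: "n \<ge> 4"
    and fP: "skew_form.extremal_labelling (arc_sign P) (\<lambda>i. i) {..<n} (n - 4)"
    and H: "switching_equivalent D H" "digraph_iso (with_proj H) (with_proj P)"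
  shows "\<exists>f. skew_form.extremal_labelling (arc_sign D) f {..<n} (n - 4)"
proof -
  note sw = extremal_labelling_switching_equivalent[OF H(1) D(1)]
  obtain g where g: "bij_betw g (pverts H) (pverts P)"
    and arcs: "\<And>u v. u \<in> pverts H \<Longrightarrow> v \<in> pverts H \<Longrightarrow> (u, v) \<in> parcs H \<longleftrightarrow> (g u, g v) \<in> parcs P"
    using H(2) by (rule digraph_iso_pairD) blast
  interpret H: skew_form "arc_sign H" using sw by (intro skew_form_arc_sign) blast
  interpret P: skew_form "arc_sign P" by (rule skew_form_arc_sign) fact
  have pH: "pverts H = {..<n}" using sw D(2) by simp
  have g': "bij_betw g {..<n} {..<n}" using g pH P(2) by simp
  define f where "f = the_inv_into {..<n} g"
  have f: "bij_betw f {..<n} {..<n}" unfolding f_def using g' by (rule bij_betw_the_inv_into)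
  have gf: "g (f i) = i" "f i < n" if "i < n" for i
    using that f f_the_inv_into_f_bij_betw[OF g', of i] by (auto simp: f_def bij_betw_def)
  have "arc_sign H (f i) (f j) = arc_sign P i j" if "i < n" "j < n" for i j
    using arcs[of "f i" "f j"] arcs[of "f j" "f i"] gf that pH by (simp add: arc_sign_def)
  hence "H.extremal_labelling f {..<n} (n - 4)"
    using fP f n unfolding H.extremal_labelling_def P.extremal_labelling_def by simp
  thus ?thesis using sw by blast
qed

theorem theorem3p3:
  fixes n :: nat
  assumes "n \<ge> 4"
  shows "(\<exists>P. plus_orientation (cycle_path_graph n 4) P) \<and>
    (\<forall>P. plus_orientation (cycle_path_graph n 4) P \<longrightarrow>
       P \<in> oriented_unicyclic n \<and>
       (\<forall>D \<in> oriented_unicyclic n.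
          skew_energy D \<le> skew_energy P \<and>
          (skew_energy D = skew_energy P \<longleftrightarrow>
             (\<exists>H. switching_equivalent D H \<and> digraph_iso (with_proj H) (with_proj P)))))"
proof (intro conjI allI impI ballI)
  show "\<exists>P. plus_orientation (cycle_path_graph n 4) P"
    using plus_orientation_increasing[OF assms] by blast
  fix P assume plus: "plus_orientation (cycle_path_graph n 4) P"
  hence orient: "orientation_of (cycle_path_graph n 4) P" by (simp add: plus_orientation_def)
  show P: "P \<in> oriented_unicyclic n"
    using orient unicyclic_cycle_path_graph[OF assms] cycle_path_graph_4(1)[OF assms]
    unfolding oriented_unicyclic_def by blast
  note Pf = oriented_unicyclic_facts[OF P]
  have lP: "skew_form.extremal_labelling (arc_sign P) (\<lambda>i. i) {..<n} (n - 4)"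
    by (rule extremal_labelling_id[OF assms orient plus_orientation_sign[OF assms plus]])
  have mP: "skew_form.minor_sum (arc_sign P) {..<n} j = extremal_count (n - 4) j" for j
    by (rule skew_form.extremal_labelling_minor_sum[OF Pf(2) lP])
  fix D assume "D \<in> oriented_unicyclic n"
  note Df = oriented_unicyclic_facts[OF this]
  have le: "\<bar>skew_form.minor_sum (arc_sign D) {0..<n} j\<bar> \<le> skew_form.minor_sum (arc_sign P) {0..<n} j" for j
    using skew_form.near_forest_minor_sum_le[OF Df(2) _ Df(3), of "n - 4" j] assms
    by (simp add: mP atLeast0LessThan)
  note e = skew_energy_int_mat[OF Df(1)] skew_energy_int_mat[OF Pf(1)]
  show "skew_energy D \<le> skew_energy P"
    unfolding e by (rule mat_energy_mono(1)[OF Df(2) Pf(2) le])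
  show "skew_energy D = skew_energy P \<longleftrightarrow>
    (\<exists>H. switching_equivalent D H \<and> digraph_iso (with_proj H) (with_proj P))"
  proof
    assume eq: "skew_energy D = skew_energy P"
    \<comment> \<open>A strict gap in this single coefficient, present because \<open>n\<close> is
      at least \<open>2 * 2\<close>, would already separate the energies.\<close>
    have "\<bar>skew_form.minor_sum (arc_sign D) {0..<n} 2\<bar> = skew_form.minor_sum (arc_sign P) {0..<n} 2"
    proof (rule ccontr)
      assume "\<not> ?thesis"
      hence "\<bar>skew_form.minor_sum (arc_sign D) {0..<n} 2\<bar> < skew_form.minor_sum (arc_sign P) {0..<n} 2"
        using le[of 2] by simp
      hence "skew_energy D < skew_energy P"
        unfolding e using assms by (intro mat_energy_mono(2)[OF Df(2) Pf(2) le, of 2]) auto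
      thus False using eq by simp
    qed
    hence "\<exists>f. skew_form.extremal_labelling (arc_sign D) f {..<n} (n - 4)"
      using assms unfolding atLeast0LessThan mP
      by (intro skew_form.extremal_labelling_exists[OF Df(2) _ Df(3)]) simp_all
    thus "\<exists>H. switching_equivalent D H \<and> digraph_iso (with_proj H) (with_proj P)"
      using extremal_labelling_iso[OF Df(4,1,5) Pf(4,1,5) assms _ lP] by blast
  next
    assume "\<exists>H. switching_equivalent D H \<and> digraph_iso (with_proj H) (with_proj P)"
    then obtain f where lD: "skew_form.extremal_labelling (arc_sign D) f {..<n} (n - 4)"
      using iso_extremal_labelling[OF Df(4,1) Pf(4,1) assms lP] by blast
    \<comment> \<open>With all coefficients equal, \<open>mat_energy_mono\<close> also applies with
      the roles of \<open>D\<close> and \<open>P\<close> exchanged.\<close>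
    have "skew_form.minor_sum (arc_sign D) {0..<n} j = extremal_count (n - 4) j" for j
      using skew_form.extremal_labelling_minor_sum[OF Df(2) lD] by (simp add: atLeast0LessThan)
    hence "\<bar>skew_form.minor_sum (arc_sign P) {0..<n} j\<bar> \<le> skew_form.minor_sum (arc_sign D) {0..<n} j" for j
      using extremal_count_nonneg by (simp add: mP atLeast0LessThan)
    hence "skew_energy P \<le> skew_energy D"
      unfolding e by (rule mat_energy_mono(1)[OF Pf(2) Df(2)])
    moreover have "skew_energy D \<le> skew_energy P"
      unfolding e by (rule mat_energy_mono(1)[OF Df(2) Pf(2) le])
    ultimately show "skew_energy D = skew_energy P" by simp
  qed
qed

end
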